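(* Let $\lambda\vdash n$ be a partition whose $2$-core has size $s=\binom{m+1}{2}$ with $m\ge 0$, and let $p>\max\{2,2m-1\}$ be a prime not dividing $\Delta(n_\lambda)$. Let $\sigma$ be the slope of the right-most edge of the Newton polygon of $R_\lambda(x)$ with respect to $p$. Then: (i) if $m=0$, then $\sigma<\frac{1}{p-1}$, and if moreover $n<p^2$ then $\sigma\le \frac1p$; (ii) if $m\ge 1$, then $\sigma\le \frac{1}{p-(2m-1)}$. Moreover the bound in (ii) is attained: for every $m\ge1$ and every prime $p>\max\{2,2m-1\}$ there is a partition $\lambda$ with $2$-core of size $\binom{m+1}2$ and $p\nmid\Delta(n_\lambda)$ for which $\sigma=\frac{1}{p-(2m-1)}$; and for every prime $p\ge 3$ there is a partition $\lambda$ with empty $2$-core and $p\nmid \Delta(n_\lambda)$ for which $\sigma\ge\frac1p$.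
   Context: $\mathrm{He}_k(x)$ denotes the monic probabilists' Hermite polynomial of degree $k$. A partition $\lambda=(\lambda_1\ge\dots\ge\lambda_r\ge 0)$ may have zero parts; $|\lambda|=\sum\lambda_i$, and $\lambda\vdash n$ means $|\lambda|=n$. Its degree sequence is $n_\lambda=(\lambda_r,\lambda_{r-1}+1,\dots,\lambda_1+r-1)$, and $\Delta(x_1,\dots,x_r)=\prod_{i<j}(x_j-x_i)$. The Wronskian Hermite polynomial is $\mathrm{He}_\lambda(x)=\mathrm{Wr}[\mathrm{He}_{n_1},\dots,\mathrm{He}_{n_r}]/\Delta(n_\lambda)$, monic of degree $|\lambda|$ with integer coefficients. Removing a $2$-hook means replacing an entry $a$ of $n_\lambda$ by $a-2\ge0$ with $a-2\notin n_\lambda$; removing $2$-hooks until impossible yields the $2$-core $\bar\lambda$, a staircase $(m,m-1,\dots,1)$ padded with zeros. $\mathrm{He}_\lambda(x)=x^{|\bar\lambda|}R_\lambda(x)$ with $R_\lambda\in\mathbb{Z}[x]$, $R_\lambda(0)\neq 0$. For $G(x)=\sum_{i=0}^N a_ix^i\in\mathbb{Z}[x]$ with $a_0\neq0$ and a prime $p$, the Newton polygon of $G$ with respect to $p$ is the lower convex hull of the points $(i,\nu_p(a_{N-i}))$, $0\le i\le N$, $a_{N-i}\ne0$, where $\nu_p$ is the $p$-adic valuation; its right-most edge is the edge ending at $(N,\nu_p(a_0))$. *)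

theory Defs
  imports "Jordan_Normal_Form.Determinant" "HOL-Computational_Algebra.Polynomial"
    "HOL-Computational_Algebra.Primes"
begin

fun herm :: "nat \<Rightarrow> int poly" where
  "herm 0 = 1"
| "herm (Suc 0) = [:0, 1:]"
| "herm (Suc (Suc k)) = [:0, 1:] * herm (Suc k) - smult (int (Suc k)) (herm k)"

text \<open>A partition is a weakly decreasing list of naturals (zero parts allowed).\<close>
definition is_partition :: "nat list \<Rightarrow> bool" where
  "is_partition lam \<longleftrightarrow> sorted_wrt (\<lambda>a b. a \<ge> b) lam"

definition part_size :: "nat list \<Rightarrow> nat" where
  "part_size lam = sum_list lam"

definition degseq :: "nat list \<Rightarrow> nat list" where
  "degseq lam = map (\<lambda>i. lam ! (length lam - 1 - i) + i) [0..<length lam]"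

definition Delta :: "nat list \<Rightarrow> int" where
  "Delta ns = (\<Prod>(i, j)\<in>{(i, j). i < j \<and> j < length ns}. int (ns ! j) - int (ns ! i))"

definition wronskian :: "int poly list \<Rightarrow> int poly" where
  "wronskian fs = det (mat (length fs) (length fs) (\<lambda>(i, j). (pderiv ^^ i) (fs ! j)))"

text \<open>Wronskian Hermite polynomial He_lam = Wr[He_n1,...,He_nr] / Delta(n_lam)
  (the division is exact; coefficients are integers).\<close>
definition He_part :: "nat list \<Rightarrow> int poly" where
  "He_part lam = map_poly (\<lambda>c. c div Delta (degseq lam)) (wronskian (map herm (degseq lam)))"

text \<open>Removal of a 2-hook on the set of entries of a degree sequence.\<close>
definition hook2_step :: "nat set \<Rightarrow> nat set \<Rightarrow> bool" where
  "hook2_step A B \<longleftrightarrow> (\<exists>a\<in>A. a \<ge> 2 \<and> a - 2 \<notin> A \<and> B = insert (a - 2) (A - {a}))"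

definition is_two_core_of :: "nat set \<Rightarrow> nat set \<Rightarrow> bool" where
  "is_two_core_of A C \<longleftrightarrow> hook2_step\<^sup>*\<^sup>* A C \<and> \<not> (\<exists>B. hook2_step C B)"

text \<open>Size of the partition with degree set C: sum of entries minus binom(r,2).\<close>
definition two_core_size :: "nat list \<Rightarrow> nat" where
  "two_core_size lam = (THE s. \<exists>C. is_two_core_of (set (degseq lam)) C \<and>
      s = \<Sum>C - (card C choose 2))"

text \<open>He_lam = x^|core| * R_lam.\<close>
definition Rpoly :: "nat list \<Rightarrow> int poly" where
  "Rpoly lam = He_part lam div [:0, 1:] ^ two_core_size lam"

definition vp :: "nat \<Rightarrow> int \<Rightarrow> nat" where
  "vp p a = multiplicity (int p) a"

text \<open>Slope of the right-most edge of the Newton polygon (lower convex hull of the points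
  (i, vp(a_(N-i))), a_(N-i) \<noteq> 0): the edge ends at (N, vp(a_0)); it is the segment joining
  that point with another point of the set such that all points lie on or above its line.\<close>
definition right_edge_slope :: "nat \<Rightarrow> int poly \<Rightarrow> real" where
  "right_edge_slope p G = (THE \<sigma>. \<exists>j<degree G. coeff G (degree G - j) \<noteq> 0 \<and>
      \<sigma> = (real (vp p (coeff G 0)) - real (vp p (coeff G (degree G - j)))) / (real (degree G) - real j) \<and>
      (\<forall>i\<le>degree G. coeff G (degree G - i) \<noteq> 0 \<longrightarrow>
         real (vp p (coeff G (degree G - i))) \<ge> real (vp p (coeff G 0)) + \<sigma> * (real i - real (degree G))))"

end

theory Submission
  imports Defs "HOL-Computational_Algebra.Polynomial_FPS"
begin

text \<open>Write the degree sequence as the set \<open>A\<close> of entries \<open>n\<^sub>j\<close>. By multilinearity the coefficients of the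
Wronskian are sums over degree vectors \<open>\<mu>\<close> with \<open>\<mu>\<^sub>j \<equiv> n\<^sub>j\<close> mod 2 of products of Hermite coefficients times
\<open>\<Delta>(\<mu>)\<close>. If \<open>p\<close> does not divide \<open>\<Delta>(A)\<close>, the term of \<open>\<mu>\<close> has valuation at least \<open>w - v(H\<^sub>\<mu>)\<close>,
where \<open>w\<close> depends only on \<open>A\<close> and \<open>H\<^sub>\<mu>\<close> is the product of the hook lengths of the partition
with degree set \<open>\<mu>\<close>. In the lowest coefficient only permutations of the 2-core survive; they form the
determinant of a matrix that Lagrange interpolation makes diagonal modulo \<open>p\<close>, so its valuation is
exactly \<open>w - v(H)\<close> for the 2-core. The slope is thus bounded by \<open>v(H\<^sub>\<mu>) / k\<close> where \<open>\<mu>\<close> has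
size \<open>s + k\<close> and the same 2-core. Finally \<open>v(H\<^sub>\<mu>) \<le> v((p w\<^sub>\<mu>)!)\<close> with \<open>w\<^sub>\<mu>\<close> the \<open>p\<close>-weight, and each of
the \<open>w\<^sub>\<mu>\<close> removals of a \<open>p\<close>-hook changes the excess of even over odd entries, which determines the size of
the 2-core, by exactly 2; this bounds \<open>k\<close> from below.\<close>

text \<open>The constant 2m-1 is the largest help that one p-hook gets from the 2-core: a removal
  can change the alternating sum d from m+1 to m-1 (or from -m to 2-m), and d(d-1)/2 then drops by
  2m-1, so one factor p may cost as little as p-(2m-1) boxes. For m = 0 there is no such drop, and
  the bounds are those for v(k!).

  The coefficients are sums whose terms may cancel, so in general their valuations can only be
  bounded from below. An exact value is needed for the lowest coefficient alone, because the slope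
  is the maximum of (v(a_0) - v(a_k))/k; in each difference w cancels.

  Integrality is not free: \<open>He_part\<close> divides coefficientwise by \<open>div\<close>, so
  it must be shown that Delta divides every coefficient of the Wronskian. For this the columns are
  rewritten as families that depend polynomially on the entries n_j.\<close>

subsection \<open>Valuations of factorials and hook products\<close>

lemma vp_mult: "prime p \<Longrightarrow> a \<noteq> 0 \<Longrightarrow> b \<noteq> 0 \<Longrightarrow> vp p (a * b) = vp p a + vp p b"
  unfolding vp_def by (rule prime_elem_multiplicity_mult_distrib) auto

lemma vp_prod:
  assumes "prime p" "finite I" "\<And>i. i \<in> I \<Longrightarrow> f i \<noteq> 0"
  shows "vp p (prod f I) = (\<Sum>i\<in>I. vp p (f i))"
  using assms(2,3) by (induction I) (auto simp: vp_mult assms(1), simp add: vp_def)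

lemma vp_not_dvd: "\<not> int p dvd a \<Longrightarrow> vp p a = 0"
  unfolding vp_def by (rule not_dvd_imp_multiplicity_0)

lemma vp_prime_times: "prime p \<Longrightarrow> a \<noteq> 0 \<Longrightarrow> vp p (int p * a) = Suc (vp p a)"
  unfolding vp_def by (subst multiplicity_times_same) (auto simp: prime_gt_1_nat not_less_eq dest: prime_gt_1_nat)

lemma vp_zero [simp]: "vp p 0 = 0" by (simp add: vp_def)

lemma vp_minus [simp]: "vp p (- a) = vp p a" by (simp add: vp_def multiplicity_def)

lemma vp_dvd_mono: "prime p \<Longrightarrow> a dvd b \<Longrightarrow> b \<noteq> 0 \<Longrightarrow> vp p a \<le> vp p b"
  unfolding vp_def by (rule dvd_imp_multiplicity_le) auto

lemma vp_ge_iff: "prime p \<Longrightarrow> a \<noteq> 0 \<Longrightarrow> k \<le> vp p a \<longleftrightarrow> int p ^ k dvd a"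
  unfolding vp_def by (subst power_dvd_iff_le_multiplicity) (auto dest: prime_gt_1_nat)

text \<open>One step of Legendre's formula: up to n only the multiples p, 2p, ... contribute, and
  their product is p^(n div p) (n div p)!. The recursive form matches the passage to slices in
  \<open>hook_val_slice\<close>.\<close>

lemma vp_fact_div:
  assumes p: "prime p"
  shows "vp p (fact n) = n div p + vp p (fact (n div p))"
proof (induction n)
  case 0
  then show ?case by simp
next
  case (Suc n)
  have S: "vp p (fact (Suc n)) = vp p (int (Suc n)) + vp p (fact n)"
    by (simp only: fact_Suc of_nat_Suc of_nat_add of_nat_1) (subst vp_mult[OF p]; simp)
  show ?case
  proof (cases "p dvd Suc n")
    case True
    then obtain q where q: "Suc n = p * q" by auto
    have p0: "p > 0" using p prime_gt_0_nat by blast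
    from q obtain q' where q': "q = Suc q'" by (cases q) auto
    have nd: "n div p = q'" using q q' p0 by (intro div_nat_eqI) auto
    have "vp p (int (Suc n)) = Suc (vp p (int q))"
      unfolding q of_nat_mult by (rule vp_prime_times) (use p q' in auto)
    moreover have "vp p (fact q) = vp p (int q) + vp p (fact q')"
      unfolding q' by (simp only: fact_Suc of_nat_Suc) (subst vp_mult[OF p]; simp)
    moreover have "Suc n div p = q" using q p0 by simp
    ultimately show ?thesis using S Suc.IH nd q' by simp
  next
    case False
    then have "Suc n div p = n div p" by (simp add: div_Suc dvd_eq_mod_eq_0)
    moreover have "vp p (int (Suc n)) = 0" using False by (intro vp_not_dvd) (simp only: int_dvd_int_iff not_False_eq_True)
    ultimately show ?thesis using S Suc.IH by simp
  qed
qed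

lemma vp_fact_less: "prime p \<Longrightarrow> n < p \<Longrightarrow> vp p (fact n) = 0"
  by (subst vp_fact_div) (auto simp: vp_def)

text \<open>Legendre's formula summed as a geometric series. Having n - 1 instead of n gives the
  strict inequality in (i) and the spare 1 that the case m = 1 needs in
  \<open>hook_val_bound_core\<close>.\<close>

lemma vp_fact_bound:
  assumes p: "prime p"
  shows "n \<ge> 1 \<Longrightarrow> vp p (fact n) * (p - 1) \<le> n - 1"
proof (induction n rule: less_induct)
  case (less n)
  show ?case
  proof (cases "n < p")
    case True
    then show ?thesis by (simp add: vp_fact_less p)
  next
    case False
    define q where "q = n div p"
    have p1: "p > 1" using p prime_gt_1_nat by blast
    have q: "q \<ge> 1" "q < n" "p * q \<le> n" using False p1 less.prems
      by (auto simp: q_def div_greater_zero_iff Suc_le_eq)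
    have "vp p (fact q) * (p - 1) \<le> q - 1" using less.IH q by blast
    then have "vp p (fact n) * (p - 1) \<le> q * (p - 1) + (q - 1)"
      by (subst vp_fact_div[OF p]) (simp add: q_def algebra_simps)
    also have "\<dots> = p * q - 1" using p1 q by (cases p; cases q) auto
    also have "\<dots> \<le> n - 1" using q by simp
    finally show ?thesis .
  qed
qed

lemma vp_fact_mono: "prime p \<Longrightarrow> m \<le> n \<Longrightarrow> vp p (fact m) \<le> vp p (fact n)"
  by (rule vp_dvd_mono) (auto simp: fact_dvd)

lemma vp_fact_add: "prime p \<Longrightarrow> vp p (fact m) + vp p (fact n) \<le> vp p (fact (m + n))"
  using vp_dvd_mono[of p "fact m * fact n" "fact (m + n)"] 
  by (simp add: vp_mult fact_fact_dvd_fact)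

text \<open>Valuation form of the integrality of multinomial coefficients.\<close>

lemma vp_fact_sum:
  assumes "prime p" "finite J"
  shows "(\<Sum>j\<in>J. vp p (fact (f j))) \<le> vp p (fact (\<Sum>j\<in>J. f j))"
  using assms(2)
proof (induction J)
  case (insert x F)
  then show ?case using vp_fact_add[OF assms(1), of "f x" "sum f F"] by simp
qed simp

text \<open>The size of the partition with the given degree set; subtraction does not truncate, see \<open>sum_ge_choose\<close>.\<close>

definition beta_size :: "nat set \<Rightarrow> nat" where "beta_size A = \<Sum>A - (card A choose 2)"

lemma double_choose_2: "2 * int (n choose 2) = int n * (int n - 1)"
proof (induction n)
  case (Suc n)
  then show ?case by (simp add: numeral_2_eq_2 algebra_simps)
qed simp

lemma sum_lessThan_choose: "(\<Sum>j<r. j) = (r choose 2)"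
  by (induction r) (auto simp: numeral_2_eq_2)

text \<open>A new maximum b lies above all of A, hence b >= card A, and equality of the sums forces
  b = card A at every stage. The equality case later singles out the 2-core.\<close>

lemma sum_ge_choose: 
  assumes "finite (A :: nat set)"
  shows "(card A choose 2) \<le> \<Sum>A \<and> (\<Sum>A = (card A choose 2) \<longrightarrow> A = {..<card A})"
  using assms
proof (induction A rule: finite_linorder_max_induct)
  case (insert b A)
  then have nb: "b \<notin> A" by auto
  have c: "card A \<le> b" using insert by (metis card_lessThan card_mono finite_lessThan lessThan_iff subsetI)
  have ch: "(card (insert b A) choose 2) = (card A choose 2) + card A"
    using nb insert by (simp add: numeral_2_eq_2)
  have s: "\<Sum>(insert b A) = b + \<Sum>A" using nb insert by simp
  show ?case 
  proof (intro conjI impI)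
    show "(card (insert b A) choose 2) \<le> \<Sum>(insert b A)" using ch s c insert by linarith
    assume "\<Sum>(insert b A) = (card (insert b A) choose 2)"
    then have "b = card A" "\<Sum>A = (card A choose 2)" using ch s c insert by linarith+
    then show "insert b A = {..<card (insert b A)}"
      using insert nb by (metis card_insert_disjoint lessThan_Suc)
  qed
qed simp

lemma sum_beta_size: "finite A \<Longrightarrow> \<Sum>A = beta_size A + (card A choose 2)"
  using sum_ge_choose[of A] by (simp add: beta_size_def)

lemma beta_size_int: "finite A \<Longrightarrow> 2 * int (beta_size A) = 2 * int (\<Sum>A) - int (card A) * (int (card A) - 1)"
  using sum_beta_size[of A] double_choose_2[of "card A"] by simp

text \<open>For \<open>j < p\<close> these are the degree sets of the components of the \<open>p\<close>-quotient.\<close>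

definition slice :: "nat \<Rightarrow> nat set \<Rightarrow> nat \<Rightarrow> nat set" where "slice p A j = {q. p * q + j \<in> A}"

lemma sum_slice:
  assumes "finite A" "p > 0"
  shows "(\<Sum>a\<in>A. f a) = (\<Sum>j<p. \<Sum>q\<in>slice p A j. f (p * q + j))"
proof -
  have "(\<Sum>j<p. \<Sum>q\<in>slice p A j. f (p * q + j)) = (\<Sum>(j,q)\<in>Sigma {..<p} (slice p A). f (p * q + j))"
    by (rule sum.Sigma) (use assms in \<open>auto simp: slice_def intro!: finite_subset[OF _ finite_vimageI[OF assms(1), of "\<lambda>q. p * q + j" for j]] inj_onI\<close>)
  also have "\<dots> = (\<Sum>a\<in>A. f a)"
    by (rule sum.reindex_bij_witness[of _ "\<lambda>a. (a mod p, a div p)" "\<lambda>(j,q). p * q + j"])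
       (use assms in \<open>auto simp: slice_def\<close>)
  finally show ?thesis ..
qed

lemma finite_slice: "finite A \<Longrightarrow> p > 0 \<Longrightarrow> finite (slice p A j)"
  unfolding slice_def
  by (rule finite_subset[OF _ finite_vimageI[of A "\<lambda>q. p * q + j"]]) (auto intro: inj_onI)

lemma card_slice:
  assumes "finite A" "p > 0"
  shows "card A = (\<Sum>j<p. card (slice p A j))"
  using sum_slice[OF assms, of "\<lambda>_. 1::nat"] by simp

section \<open>Parity counts, the 2-quotient and the p-weight\<close>

definition alt_sum :: "nat set \<Rightarrow> int" where "alt_sum A = (\<Sum>a\<in>A. (-1) ^ a)"

lemma lessThan_2: "{..<2} = {0, 1::nat}" by auto

lemma card_alt_sum_slices:
  assumes "finite A"
  shows "card A = card (slice 2 A 0) + card (slice 2 A 1)"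
    and "alt_sum A = int (card (slice 2 A 0)) - int (card (slice 2 A 1))"
    and "\<Sum>A = 2 * \<Sum>(slice 2 A 0) + 2 * \<Sum>(slice 2 A 1) + card (slice 2 A 1)"
  using card_slice[OF assms, of 2] sum_slice[OF assms, of 2 "\<lambda>a. (-1) ^ a :: int"]
     sum_slice[OF assms, of 2 "\<lambda>a. a"]
  by (auto simp: alt_sum_def lessThan_2 sum.distrib sum_distrib_left)

text \<open>The size formula for core and quotient, |A| = |core| + 2 (|A_0| + |A_1|), doubled to
  avoid halves: d(d-1)/2 is the size of the staircase whose even entries outnumber the odd ones by
  d.\<close>

lemma beta_size_ge_core:
  assumes A: "finite A"
  shows "2 * int (beta_size A) = alt_sum A * (alt_sum A - 1) + 4 * int (beta_size (slice 2 A 0)) + 4 * int (beta_size (slice 2 A 1))"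
proof -
  define E where "E = slice 2 A 0"
  define O' where "O' = slice 2 A 1"
  have fin: "finite E" "finite O'" using finite_slice[OF A] by (auto simp: E_def O'_def)
  note * = card_alt_sum_slices[OF A, folded E_def O'_def]
  note ** = beta_size_int[OF fin(1)] beta_size_int[OF fin(2)] beta_size_int[OF A]
  have "2 * int (beta_size A) = 4 * int (\<Sum>E) + 4 * int (\<Sum>O') + 2 * int (card O') 
     - (int (card E) + int (card O')) * (int (card E) + int (card O') - 1)"
    using * ** by simp
  then show ?thesis using ** unfolding *(2) E_def[symmetric] O'_def[symmetric]
    by (simp add: algebra_simps)
qed

lemma downward_closed_eq_lessThan:
  assumes "finite (S :: nat set)" "\<And>q. Suc q \<in> S \<Longrightarrow> q \<in> S"
  shows "S = {..<card S}"
proof (cases "S = {}")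
  case False
  have down: "i \<in> S" if "q \<in> S" "i \<le> q" for q i
    using that
  proof (induction q)
    case (Suc q)
    then show ?case using assms(2)[of q] by (cases "i = Suc q") auto
  qed simp
  have "S = {..<Suc (Max S)}"
  proof
    show "S \<subseteq> {..<Suc (Max S)}" using assms(1) by (auto simp: less_Suc_eq_le)
    show "{..<Suc (Max S)} \<subseteq> S"
      using down[OF Max_in[OF assms(1) False]] by (simp add: less_Suc_eq_le subset_iff)
  qed
  then obtain n where n: "S = {..<n}" by blast
  show ?thesis unfolding n by simp
qed simp

text \<open>Encoded through the p-quotient, so that no sequence of removals has to be chosen; each
  removal of a p-hook lowers it by exactly 1.\<close>

definition pweight :: "nat \<Rightarrow> nat set \<Rightarrow> nat" where
  "pweight p A = (\<Sum>j<p. beta_size (slice p A j))"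

text \<open>The number \<open>j\<close> is half the change of the alternating sum on the way to the \<open>p\<close>-core, and \<open>d (d - 1) / 2\<close> is
the least size for alternating sum \<open>d\<close>.\<close>

lemma pcore_bound:
  assumes p: "odd p"
  shows "finite A \<Longrightarrow> \<exists>j. \<bar>j\<bar> \<le> int (pweight p A) \<and> 
     2 * int (beta_size A) \<ge> 2 * int p * int (pweight p A) + (alt_sum A - 2 * j) * (alt_sum A - 2 * j - 1)"
proof (induction "\<Sum>A" arbitrary: A rule: less_induct)
  case less
  have p0: "p > 0" using p by (cases p) auto
  show ?case
  proof (cases "\<exists>a\<in>A. a \<ge> p \<and> a - p \<notin> A")
    case True
    then obtain a where a: "a \<in> A" "a \<ge> p" "a - p \<notin> A" by auto
    define A' where "A' = insert (a - p) (A - {a})"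
    define q where "q = a div p - 1"
    define j0 where "j0 = a mod p"
    have "Suc q = a div p" using a p0 unfolding q_def by (simp add: div_greater_zero_iff)
    then have aq: "a = p * Suc q + j0" by (simp add: j0_def)
    have j0: "j0 < p" using p0 by (simp add: j0_def)
    have fA': "finite A'" using less.prems by (simp add: A'_def)
    have cA: "card A' = card A" using a less.prems card_Suc_Diff1[of A a] by (simp add: A'_def)
    have sA: "\<Sum>A = \<Sum>A' + p" using a less.prems unfolding A'_def
      by (simp add: sum.remove[of A a "\<lambda>x. x"])
    \<comment> \<open>As p is odd, a and a - p have opposite parities, so the moved entry reverses
      its sign.\<close>
    have dA: "alt_sum A' = alt_sum A - 2 * (-1) ^ a"
    proof -
      have "(-1::int) ^ (a - p) = - ((-1) ^ a)" using a p by (auto simp: minus_one_power_iff)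
      then show ?thesis using a less.prems unfolding A'_def alt_sum_def
        by (simp add: sum.remove[of A a "\<lambda>x. (-1) ^ x"])
    qed
    \<comment> \<open>On the abacus with p runners the removal moves one bead of runner
      \<open>j0\<close> from position q + 1 to q and leaves the other runners alone.\<close>
    have sl: "slice p A' j0 = insert q (slice p A j0 - {Suc q})"
    proof -
      have "p * x + j0 = a - p \<longleftrightarrow> x = q" "p * x + j0 = a \<longleftrightarrow> x = Suc q" for x
      proof -
        have "a - p = p * q + j0" using aq by simp
        then show "p * x + j0 = a - p \<longleftrightarrow> x = q" "p * x + j0 = a \<longleftrightarrow> x = Suc q"
          using p0 unfolding aq by (simp_all del: mult_Suc_right)
      qed
      then show ?thesis unfolding slice_def A'_def by auto
    qed
    have sl': "slice p A' j = slice p A j" if "j < p" "j \<noteq> j0" for j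
    proof -
      have "p * x + j \<noteq> a - p" "p * x + j \<noteq> a" for x
      proof -
        have "(p * x + j) mod p = j" "(p * q + j0) mod p = j0" "(p * Suc q + j0) mod p = j0" 
          using that j0 by (simp_all only: mod_mult_self4 mod_less)
        moreover have "a - p = p * q + j0" using aq by simp
        ultimately show "p * x + j \<noteq> a - p" "p * x + j \<noteq> a" using aq that by metis+
      qed
      then show ?thesis unfolding slice_def A'_def by auto
    qed
    have q_in: "Suc q \<in> slice p A j0" "q \<notin> slice p A j0" using a aq by (auto simp: slice_def)
    have fs: "finite (slice p A j0)" using finite_slice less.prems p0 by auto
    have "card (slice p A' j0) = card (slice p A j0)" using q_in fs card_Suc_Diff1[OF fs q_in(1)] by (simp add: sl)
    moreover have "\<Sum>(slice p A j0) = \<Sum>(slice p A' j0) + 1" using q_in fs unfolding sl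
      by (simp add: sum.remove[of "slice p A j0" "Suc q" "\<lambda>x. x"])
    ultimately have "beta_size (slice p A j0) = beta_size (slice p A' j0) + 1"
      using sum_beta_size[OF fs] sum_beta_size[OF finite_slice[OF fA' p0, of j0]] by simp
    then have w: "pweight p A = pweight p A' + 1"
      unfolding pweight_def using j0 sl' by (simp add: sum.remove[of "{..<p}" j0])
    have "\<Sum>A' < \<Sum>A" using sA p0 by simp
    then obtain j where j: "\<bar>j\<bar> \<le> int (pweight p A')"
      "2 * int (beta_size A') \<ge> 2 * int p * int (pweight p A') + (alt_sum A' - 2 * j) * (alt_sum A' - 2 * j - 1)"
      using less.hyps fA' by blast
    have sizA: "beta_size A = beta_size A' + p" using sum_beta_size[OF less.prems] sum_beta_size[OF fA'] sA cA by simp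
    \<comment> \<open>The new witness records the sign of this removal, so
      \<open>alt_sum A - 2 * j\<close> remains the alternating sum of the p-core reached at the
      end.\<close>
    have "\<bar>j + (-1) ^ a\<bar> \<le> int (pweight p A)" using j w by (auto simp: minus_one_power_iff)
    moreover have "alt_sum A - 2 * (j + (-1) ^ a) = alt_sum A' - 2 * j" using dA by simp
    ultimately show ?thesis using j(2) sizA w by (intro exI[of _ "j + (-1) ^ a"]) (simp add: algebra_simps)
  next
    case False
    \<comment> \<open>Without removable p-hooks every runner is an initial segment, so the weight is
      0 and only the lower bound d(d-1)/2 remains.\<close>
    have "beta_size (slice p A j) = 0" for j
    proof -
      let ?S = "slice p A j"
      have fs: "finite ?S" using finite_slice less.prems p0 by auto
      have "?S = {..<card ?S}"
      proof (rule downward_closed_eq_lessThan[OF fs])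
        fix q assume "Suc q \<in> ?S"
        then show "q \<in> ?S" using False by (auto simp: slice_def dest!: bspec[of _ _ "p * Suc q + j"])
      qed
      then obtain n where n: "?S = {..<n}" by blast
      show ?thesis unfolding beta_size_def n by (simp add: sum_lessThan_choose)
    qed
    then have "pweight p A = 0" by (simp add: pweight_def)
    then show ?thesis using beta_size_ge_core[OF less.prems] by (intro exI[of _ 0]) simp
  qed
qed

lemma int_mult_pred_nonneg: "(x::int) * (x - 1) \<ge> 0"
  by (cases "x \<ge> 1") (auto intro: mult_nonneg_nonneg mult_nonpos_nonpos)

lemma pweight_le: "odd p \<Longrightarrow> finite A \<Longrightarrow> p * pweight p A \<le> beta_size A"
proof -
  assume "odd p" "finite A"
  from pcore_bound[OF this] obtain j where 
    "2 * int (beta_size A) \<ge> 2 * int p * int (pweight p A) + (alt_sum A - 2 * j) * (alt_sum A - 2 * j - 1)" by blast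
  then have "int (p * pweight p A) \<le> int (beta_size A)" using int_mult_pred_nonneg[of "alt_sum A - 2 * j"] by simp
  then show ?thesis by linarith
qed

text \<open>Twice the valuation of the product of the hook lengths \<open>\<Prod>a! / \<Prod>(b - a)\<close>. The double sum runs over
ordered pairs, and its diagonal contributes nothing because \<open>vp p 0 = 0\<close>.\<close>

definition hook_val :: "nat \<Rightarrow> nat set \<Rightarrow> int" where
  "hook_val p A = 2 * (\<Sum>a\<in>A. int (vp p (fact a))) - (\<Sum>a\<in>A. \<Sum>b\<in>A. int (vp p (int a - int b)))"

text \<open>The hook lengths divisible by p are p times the hook lengths of the p-quotient. In the
  defining sums, (pq+j)! contributes q + v(q!), and a difference contributes 1 + v(q - q') inside a
  residue class and nothing across classes. The linear parts 2 sum q - c(c-1), with c the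
  cardinality of the slice, form twice the size of that slice.\<close>

lemma hook_val_slice:
  assumes p: "prime p" and A: "finite A"
  shows "hook_val p A = (\<Sum>j<p. 2 * int (beta_size (slice p A j)) + hook_val p (slice p A j))"
proof -
  have p0: "p > 0" using p prime_gt_0_nat by blast
  let ?S = "slice p A"
  have fs: "finite (?S j)" for j using finite_slice A p0 by auto
  have F: "(\<Sum>a\<in>A. int (vp p (fact a))) = (\<Sum>j<p. \<Sum>q\<in>?S j. int q + int (vp p (fact q)))"
    unfolding sum_slice[OF A p0, of "\<lambda>a. int (vp p (fact a))"]
    by (intro sum.cong refl) (subst vp_fact_div[OF p], simp)
  have v: "int (vp p (int (p * q + j) - int (p * q' + j'))) = 
      (if j = j' \<and> q \<noteq> q' then 1 + int (vp p (int q - int q')) else 0)" if "j < p" "j' < p" for q q' j j'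
  proof (cases "j = j'")
    case True
    then have "int (p * q + j) - int (p * q' + j') = int p * (int q - int q')" by (simp add: algebra_simps)
    then show ?thesis using True vp_prime_times[OF p, of "int q - int q'"] by auto
  next
    case False
    have "\<not> int p dvd int (p * q + j) - int (p * q' + j')"
    proof
      assume "int p dvd int (p * q + j) - int (p * q' + j')"
      then have "int (p * q + j) mod int p = int (p * q' + j') mod int p" by (simp only: mod_eq_dvd_iff)
      then have "(p * q + j) mod p = (p * q' + j') mod p" by (metis of_nat_eq_iff of_nat_mod)
      then show False using that False by simp
    qed
    then show ?thesis using False vp_not_dvd by simp
  qed
  \<comment> \<open>One less than the cardinality, since the diagonal pair has difference 0, where
    \<open>vp\<close> is 0.\<close>
  have inner: "(\<Sum>b\<in>A. int (vp p (int (p * q + j) - int b))) = 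
      int (card (?S j)) - 1 + (\<Sum>q'\<in>?S j. int (vp p (int q - int q')))" if "j < p" "q \<in> ?S j" for q j
  proof -
    have "(\<Sum>b\<in>A. int (vp p (int (p * q + j) - int b))) = 
       (\<Sum>j'<p. \<Sum>q'\<in>?S j'. int (vp p (int (p * q + j) - int (p * q' + j'))))"
      by (rule sum_slice[OF A p0])
    also have "\<dots> = (\<Sum>j'<p. if j = j' then \<Sum>q'\<in>?S j. (if q \<noteq> q' then 1 + int (vp p (int q - int q')) else 0) else 0)"
      using that by (intro sum.cong refl) (auto simp: v simp del: of_nat_add of_nat_mult intro!: sum.cong)
    also have "\<dots> = (\<Sum>q'\<in>?S j. (if q \<noteq> q' then 1 + int (vp p (int q - int q')) else 0))"
      using that by simp
    also have "\<dots> = (\<Sum>q'\<in>?S j - {q}. 1 + int (vp p (int q - int q')))"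
      using that fs by (subst sum.remove[of _ q]) (auto intro!: sum.cong)
    also have "\<dots> = int (card (?S j - {q})) + (\<Sum>q'\<in>?S j - {q}. int (vp p (int q - int q')))"
      by (simp add: sum.distrib)
    also have "(\<Sum>q'\<in>?S j - {q}. int (vp p (int q - int q'))) = (\<Sum>q'\<in>?S j. int (vp p (int q - int q')))"
      using that fs by (subst (2) sum.remove[of _ q]) auto
    also have "int (card (?S j - {q})) = int (card (?S j)) - 1"
      using that fs by (metis card_Suc_Diff1 add_diff_cancel_left' of_nat_Suc)
    finally show ?thesis .
  qed
  have T: "(\<Sum>a\<in>A. \<Sum>b\<in>A. int (vp p (int a - int b))) = 
     (\<Sum>j<p. \<Sum>q\<in>?S j. int (card (?S j)) - 1 + (\<Sum>q'\<in>?S j. int (vp p (int q - int q'))))"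
    unfolding sum_slice[OF A p0, of "\<lambda>a. \<Sum>b\<in>A. int (vp p (int a - int b))"]
    by (intro sum.cong refl) (subst inner, auto)
  have "hook_val p A = (\<Sum>j<p. 2 * (\<Sum>q\<in>?S j. int q + int (vp p (fact q))) - 
     (\<Sum>q\<in>?S j. int (card (?S j)) - 1 + (\<Sum>q'\<in>?S j. int (vp p (int q - int q')))))"
    unfolding hook_val_def F T sum_subtractf sum_distrib_left ..
  also have "\<dots> = (\<Sum>j<p. 2 * int (beta_size (?S j)) + hook_val p (?S j))"
    by (intro sum.cong refl) (simp add: hook_val_def sum.distrib sum_subtractf beta_size_int[OF fs] algebra_simps)
  finally show ?thesis .
qed

lemma sum_slice_le:
  assumes "finite A" "j < p"
  shows "p * \<Sum>(slice p A j) \<le> \<Sum>A"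
proof -
  have p0: "p > 0" using assms by auto
  have "p * \<Sum>(slice p A j) \<le> (\<Sum>q\<in>slice p A j. p * q + j)"
    by (simp add: sum_distrib_left sum_mono)
  also have "\<dots> \<le> (\<Sum>j<p. \<Sum>q\<in>slice p A j. p * q + j)"
    using assms by (intro member_le_sum[of j]) auto
  also have "\<dots> = \<Sum>A" using sum_slice[OF assms(1) p0, of "\<lambda>a. a"] by simp
  finally show ?thesis .
qed

text \<open>By \<open>hook_val_slice\<close> the valuation is w plus that of the quotient. The
  components of the quotient have total size w, so by induction they contribute at most v(w!), and w
  + v(w!) = v((pw)!). The last bound then follows from pw <= size.\<close>

lemma hook_val_bounds:
  assumes p: "prime p" "odd p"
  shows "finite A \<Longrightarrow> 0 \<le> hook_val p A \<and> hook_val p A \<le> 2 * int (vp p (fact (p * pweight p A)))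
     \<and> hook_val p A \<le> 2 * int (vp p (fact (beta_size A)))"
proof (induction "\<Sum>A" arbitrary: A rule: less_induct)
  case less
  have p1: "p > 1" using p prime_gt_1_nat by blast
  show ?case
  \<comment> \<open>Sum 0 is split off because passing to slices lowers the sum strictly only when
    it is positive.\<close>
  proof (cases "\<Sum>A = 0")
    case True
    then have "\<And>a. a \<in> A \<Longrightarrow> a = 0" using less.prems by simp
    then have "A = {} \<or> A = {0}" by auto
    then have "hook_val p A = 0" by (auto simp: hook_val_def vp_def)
    then show ?thesis by simp
  next
    case False
    let ?S = "slice p A"
    have fs: "finite (?S j)" for j using finite_slice less.prems p1 by auto
    have lt: "\<Sum>(?S j) < \<Sum>A" if "j < p" for j
    proof -
      have le: "p * \<Sum>(?S j) \<le> \<Sum>A" using sum_slice_le[OF less.prems that] .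
      have "2 * \<Sum>(?S j) \<le> p * \<Sum>(?S j)" using p1 by (intro mult_right_mono) auto
      then show ?thesis using le False by linarith
    qed
    have IH: "0 \<le> hook_val p (?S j) \<and> hook_val p (?S j) \<le> 2 * int (vp p (fact (beta_size (?S j))))" if "j < p" for j
      using less.hyps[OF lt[OF that] fs] by blast
    have eq: "hook_val p A = 2 * int (pweight p A) + (\<Sum>j<p. hook_val p (?S j))"
      unfolding hook_val_slice[OF p(1) less.prems] pweight_def by (simp add: sum.distrib sum_distrib_left)
    have "(\<Sum>j<p. hook_val p (?S j)) \<le> (\<Sum>j<p. 2 * int (vp p (fact (beta_size (?S j)))))"
      using IH by (intro sum_mono) auto
    also have "\<dots> = 2 * int (\<Sum>j<p. vp p (fact (beta_size (?S j))))" by (simp add: sum_distrib_left)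
    also have "\<dots> \<le> 2 * int (vp p (fact (pweight p A)))" 
      unfolding pweight_def using vp_fact_sum[OF p(1), of "{..<p}" "\<lambda>j. beta_size (?S j)"]
      by (simp del: of_nat_sum)
    finally have "hook_val p A \<le> 2 * int (pweight p A + vp p (fact (pweight p A)))" using eq by simp
    also have "pweight p A + vp p (fact (pweight p A)) = vp p (fact (p * pweight p A))"
      using vp_fact_div[OF p(1), of "p * pweight p A"] p1 by simp
    finally have le: "hook_val p A \<le> 2 * int (vp p (fact (p * pweight p A)))" .
    have "vp p (fact (p * pweight p A)) \<le> vp p (fact (beta_size A))"
      by (rule vp_fact_mono[OF p(1) pweight_le[OF p(2) less.prems]])
    moreover have "(\<Sum>j<p. hook_val p (?S j)) \<ge> 0" using IH by (intro sum_nonneg) auto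
    then have "0 \<le> hook_val p A" using eq by simp
    ultimately show ?thesis using le by auto
  qed
qed

text \<open>With w removals of p-hooks and net parity change j, \<open>pcore_bound\<close> gives k
  >= pw - j(2m+1-2j). For w < p the valuation is at most w, and each hook saves at most 2m-1. For w
  >= p the valuation may exceed w, but the saving is concave in j and stays below a bound that does
  not grow with w.\<close>

lemma hook_val_bound_core:
  assumes p: "prime p" "odd p" and m: "m \<ge> 1" "p > 2 * m - 1" and A: "finite A"
    and d: "alt_sum A = int m + 1 \<or> alt_sum A = - int m"
  shows "hook_val p A * (int p - (2 * int m - 1)) \<le> 2 * (int (beta_size A) - int ((m + 1) choose 2))"
proof -
  define w where "w = int (pweight p A)"
  define V where "V = int (vp p (fact (p * pweight p A)))"
  define k where "k = int (beta_size A) - int ((m + 1) choose 2)"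
  define M where "M = int m"
  define P where "P = int p"
  have P: "P \<ge> 2 * M + 1" using m p(2) unfolding P_def M_def by presburger
  have M: "M \<ge> 1" using m by (simp add: M_def)
  obtain j0 where j0: "\<bar>j0\<bar> \<le> w" 
    "2 * int (beta_size A) \<ge> 2 * P * w + (alt_sum A - 2 * j0) * (alt_sum A - 2 * j0 - 1)"
    using pcore_bound[OF p(2) A] unfolding w_def P_def by blast
  have ch: "2 * int ((m + 1) choose 2) = M * (M + 1)" using double_choose_2[of "m+1"] by (simp add: M_def)
  \<comment> \<open>The two possible alternating sums are exchanged by d -> 1 - d, which preserves
    d(d-1) and turns j into -j.\<close>
  have "\<exists>j. \<bar>j\<bar> \<le> w \<and> k \<ge> P * w - j * (2 * M + 1 - 2 * j)"
    using d
  proof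
    assume "alt_sum A = int m + 1"
    then have d1: "alt_sum A = M + 1" by (simp add: M_def)
    have "2 * k \<ge> 2 * (P * w - j0 * (2 * M + 1 - 2 * j0))" using j0(2) ch unfolding k_def d1
      by (simp add: algebra_simps)
    then show ?thesis using j0 by auto
  next
    assume "alt_sum A = - int m"
    then have d1: "alt_sum A = - M" by (simp add: M_def)
    have "2 * k \<ge> 2 * (P * w - (-j0) * (2 * M + 1 - 2 * (-j0)))" using j0(2) ch unfolding k_def d1
      by (simp add: algebra_simps)
    then show ?thesis using j0 by (intro exI[of _ "-j0"]) auto
  qed
  then obtain j where j: "\<bar>j\<bar> \<le> w" "k \<ge> P * w - j * (2 * M + 1 - 2 * j)" by auto
  have hV: "hook_val p A \<le> 2 * V" using hook_val_bounds[OF p A] by (simp add: V_def)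
  have w0: "w \<ge> 0" by (simp add: w_def)
  have p1: "p > 1" using p prime_gt_1_nat by blast
  have Vw: "V = w + int (vp p (fact (pweight p A)))"
      using vp_fact_div[OF p(1), of "p * pweight p A"] p1 by (simp add: V_def w_def)
  have "V * (P - (2 * M - 1)) \<le> k"
  proof (cases "pweight p A < p")
    case True
    then have Vw: "V = w" using Vw vp_fact_less[OF p(1)] by simp
    have "j * (2 * M + 1 - 2 * j) \<le> w * (2 * M - 1)"
    proof (cases "j \<le> 0")
      case True
      have "j * (2 * M + 1 - 2 * j) \<le> 0" using True M by (intro mult_nonpos_nonneg) auto
      also have "0 \<le> w * (2 * M - 1)" using w0 M by auto
      finally show ?thesis .
    next
      case False
      have "j * (2 * M + 1 - 2 * j) \<le> j * (2 * M - 1)" using False by (intro mult_left_mono) auto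
      also have "\<dots> \<le> w * (2 * M - 1)" using j M by (intro mult_right_mono) auto
      finally show ?thesis .
    qed
    then show ?thesis using j(2) unfolding Vw by (simp add: algebra_simps)
  next
    case False
    then have wP: "w \<ge> P" by (simp add: w_def P_def)
    have "vp p (fact (p * pweight p A)) * (p - 1) \<le> p * pweight p A - 1"
      by (rule vp_fact_bound[OF p(1)]) (use False p1 in auto)
    then have "int (vp p (fact (p * pweight p A)) * (p - 1)) \<le> int (p * pweight p A - 1)" by linarith
    then have V1: "V * (P - 1) \<le> P * w - 1" using False p1
      by (simp add: V_def w_def P_def of_nat_diff Suc_le_eq)
    have VP: "V \<ge> P" using Vw wP by simp
    \<comment> \<open>The maximum of the quadratic in j is (2M+1)^2/8, which P (2M-2) absorbs once M
      >= 2. For M = 1 that product vanishes, and the integer maximum 1 is covered by the spare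
      1.\<close>
    have jb: "j * (2 * M + 1 - 2 * j) \<le> 1 + P * (2 * M - 2)"
    proof (cases "M = 1")
      case True
      have "0 \<le> (j - 1) * (2 * j - 1)" 
        by (cases "j \<ge> 1") (auto intro: mult_nonneg_nonneg mult_nonpos_nonpos)
      then show ?thesis unfolding True by (simp add: algebra_simps)
    next
      case False
      have "0 \<le> (4 * j - (2 * M + 1))\<^sup>2" by simp
      then have "8 * (j * (2 * M + 1 - 2 * j)) \<le> (2 * M + 1) * (2 * M + 1)"
        by (simp add: power2_eq_square algebra_simps)
      also have "\<dots> \<le> (2 * M + 1) * (8 * (2 * M - 2))" using False M by (intro mult_left_mono) auto
      also have "\<dots> \<le> P * (8 * (2 * M - 2))" using P M by (intro mult_right_mono) auto
      finally have "8 * (j * (2 * M + 1 - 2 * j)) \<le> 8 * (P * (2 * M - 2))" by (simp only: mult.left_commute)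
      then show ?thesis by linarith
    qed
    \<comment> \<open>In this splitting the first product is bounded above by Legendre's estimate,
      the subtracted one below by V >= P.\<close>
    have "V * (P - (2 * M - 1)) = V * (P - 1) - V * (2 * M - 2)" by (simp add: algebra_simps)
    also have "\<dots> \<le> P * w - 1 - P * (2 * M - 2)" using V1 VP M by (intro diff_mono mult_right_mono) auto
    also have "\<dots> \<le> P * w - j * (2 * M + 1 - 2 * j)" using jb by simp
    finally show ?thesis using j(2) by simp
  qed
  then have "2 * V * (P - (2 * M - 1)) \<le> 2 * k" by simp
  moreover have "hook_val p A * (P - (2 * M - 1)) \<le> 2 * V * (P - (2 * M - 1))"
    using hV P by (intro mult_right_mono) auto
  ultimately show ?thesis unfolding k_def P_def M_def by linarith
qed

subsection \<open>Vandermonde determinants\<close>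

text \<open>The falling factorial x(x-1)...(x-i+1): the factor that i-fold differentiation puts in
  front of x^(n-i), and equally in front of He_(n-i).\<close>

definition ffpoly :: "nat \<Rightarrow> int poly" where "ffpoly i = (\<Prod>l<i. [:- int l, 1:])"

lemma ffpoly_0 [simp]: "ffpoly 0 = 1" by (simp add: ffpoly_def)

lemma ffpoly_Suc: "ffpoly (Suc i) = [:- int i, 1:] * ffpoly i" 
  by (simp add: ffpoly_def mult.commute)

lemma monic_linear_prod:
  assumes "finite I"
  shows "degree (\<Prod>i\<in>I. [:- f i, 1:] :: int poly) = card I" "coeff (\<Prod>i\<in>I. [:- f i, 1:] :: int poly) (card I) = 1"
proof -
  show d: "degree (\<Prod>i\<in>I. [:- f i, 1:] :: int poly) = card I"
    using assms by (simp add: degree_prod_eq_sum_degree)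
  have "lead_coeff (\<Prod>i\<in>I. [:- f i, 1:] :: int poly) = 1" by (simp only: lead_coeff_prod) simp
  then show "coeff (\<Prod>i\<in>I. [:- f i, 1:] :: int poly) (card I) = 1" by (simp only: d)
qed

lemma degree_ffpoly: "degree (ffpoly i) = i" "coeff (ffpoly i) i = 1"
  using monic_linear_prod[of "{..<i}" int] by (auto simp: ffpoly_def)

lemma poly_ffpoly_nat: "poly (ffpoly i) (int n) * fact (n - i) = (if i \<le> n then fact n else 0)"
proof (induction i)
  case (Suc i)
  show ?case
  proof (cases "Suc i \<le> n")
    case True
    have *: "fact (n - i) = (int n - int i) * fact (n - Suc i)"
    proof -
      have "n - i = Suc (n - Suc i)" using True by simp
      then have "fact (n - i) = int (Suc (n - Suc i)) * fact (n - Suc i)" by (simp only: fact_Suc)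
      moreover have "int (Suc (n - Suc i)) = int n - int i" using True by simp
      ultimately show ?thesis by simp
    qed
    have "poly (ffpoly (Suc i)) (int n) * fact (n - Suc i) = poly (ffpoly i) (int n) * ((int n - int i) * fact (n - Suc i))"
      by (simp add: ffpoly_Suc algebra_simps)
    also have "\<dots> = poly (ffpoly i) (int n) * fact (n - i)" by (simp only: *)
    finally have "poly (ffpoly (Suc i)) (int n) * fact (n - Suc i) = poly (ffpoly i) (int n) * fact (n - i)" .
    then show ?thesis using Suc True by simp
  next
    case False
    then show ?thesis using Suc by (cases "i = n") (auto simp: ffpoly_Suc)
  qed
qed simp

definition vandermonde :: "nat \<Rightarrow> (nat \<Rightarrow> int) \<Rightarrow> int" where
  "vandermonde r x = (\<Prod>j<r. \<Prod>i<j. x j - x i)"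

lemma vandermonde_Suc: "vandermonde (Suc r) x = vandermonde r x * (\<Prod>i<r. x r - x i)" by (simp add: vandermonde_def)

lemma Delta_vandermonde: "Delta ns = vandermonde (length ns) (\<lambda>i. int (ns ! i))"
proof -
  have "{(i, j). i < j \<and> j < length ns} = prod.swap ` Sigma {..<length ns} (\<lambda>j. {..<j})" by auto
  then have "Delta ns = (\<Prod>(j, i)\<in>Sigma {..<length ns} (\<lambda>j. {..<j}). int (ns ! j) - int (ns ! i))"
    unfolding Delta_def by (simp add: prod.reindex case_prod_beta)
  also have "\<dots> = vandermonde (length ns) (\<lambda>i. int (ns ! i))"
    unfolding vandermonde_def by (subst prod.Sigma) auto
  finally show ?thesis .
qed

lemma vandermonde_nonzero_iff: "vandermonde r x \<noteq> 0 \<longleftrightarrow> inj_on x {..<r}"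
proof
  assume "vandermonde r x \<noteq> 0"
  then have *: "x j \<noteq> x i" if "j < r" "i < j" for i j using that by (auto simp: vandermonde_def)
  show "inj_on x {..<r}"
  proof (rule inj_onI)
    fix i j assume "i \<in> {..<r}" "j \<in> {..<r}" "x i = x j"
    then show "i = j" using *[of i j] *[of j i] by (cases i j rule: linorder_cases) auto
  qed
next
  assume inj: "inj_on x {..<r}"
  have "x j - x i \<noteq> 0" if "j < r" "i < j" for i j using inj_onD[OF inj, of i j] that by auto
  then show "vandermonde r x \<noteq> 0" by (auto simp: vandermonde_def)
qed

text \<open>Laplace expansion with the last argument X left free: the coefficients do not depend on
  X, so the determinant becomes a function of X whose zeros at the other arguments can be exploited.
  The same form serves polynomial and power series entries.\<close>

lemma det_last_column:
  fixes F :: "nat \<Rightarrow> 'b \<Rightarrow> 'a :: comm_ring_1"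
  obtains C where "\<And>X. det (mat (Suc r) (Suc r) (\<lambda>(i,j). F i (if j = r then X else x j))) = (\<Sum>i\<le>r. C i * F i X)"
    "\<And>i. i \<le> r \<Longrightarrow> C i = (-1) ^ (i + r) * det (mat r r (\<lambda>(i',j). F (if i' < i then i' else Suc i') (x j)))"
proof -
  define C where "C i = (-1) ^ (i + r) * det (mat r r (\<lambda>(i',j). F (if i' < i then i' else Suc i') (x j)))" for i
  have "det (mat (Suc r) (Suc r) (\<lambda>(i,j). F i (if j = r then X else x j))) = (\<Sum>i\<le>r. C i * F i X)" for X
  proof -
    let ?A = "mat (Suc r) (Suc r) (\<lambda>(i,j). F i (if j = r then X else x j))"
    have "det ?A = (\<Sum>i<Suc r. ?A $$ (i, r) * cofactor ?A i r)"
      by (rule laplace_expansion_column[of _ "Suc r"]) auto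
    also have "\<dots> = (\<Sum>i<Suc r. C i * F i X)"
    proof (rule sum.cong[OF refl])
      fix i assume "i \<in> {..<Suc r}"
      then have i: "i < Suc r" by simp
      have "mat_delete ?A i r = mat r r (\<lambda>(i',j). F (if i' < i then i' else Suc i') (x j))"
        by (rule eq_matI) (auto simp: mat_delete_def)
      then show "?A $$ (i, r) * cofactor ?A i r = C i * F i X"
        using i by (simp add: cofactor_def C_def)
    qed
    finally show ?thesis by (simp add: lessThan_Suc_atMost)
  qed
  then show ?thesis using that C_def by blast
qed

lemma det_repeated_column:
  fixes F :: "nat \<Rightarrow> 'b \<Rightarrow> 'a :: comm_ring_1"
  assumes "\<not> inj_on x {..<r}"
  shows "det (mat r r (\<lambda>(i,j). F i (x j))) = 0"
proof -
  obtain a b where "a < r" "b < r" "a \<noteq> b" "x a = x b" using assms by (auto simp: inj_on_def)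
  then show ?thesis
    by (intro det_identical_columns[of _ r a b]) (simp_all add: eq_vecI)
qed

lemma not_inj_on_override: "j < r \<Longrightarrow> \<not> inj_on (\<lambda>j'. if j' = r then x j else x j') {..<Suc r}"
proof
  assume "j < r" and inj: "inj_on (\<lambda>j'. if j' = r then x j else x j') {..<Suc r}"
  then have "j = r" using inj_onD[OF inj, of j r] by simp
  then show False using \<open>j < r\<close> by simp
qed

text \<open>Roots are split off one at a time: each linear factor is monic, so the cofactor stays
  integral, and distinctness keeps the next root a root of the cofactor.\<close>

lemma prod_roots_dvd:
  fixes q :: "int poly" and x :: "nat \<Rightarrow> int"
  assumes "inj_on x {..<r}" "\<And>j. j < r \<Longrightarrow> poly q (x j) = 0"
  shows "\<exists>q'. q = (\<Prod>i<r. [:- x i, 1:]) * q'"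
  using assms
proof (induction r)
  case 0
  then show ?case by simp
next
  case (Suc r)
  then obtain q' where q': "q = (\<Prod>i<r. [:- x i, 1:]) * q'" by (auto simp: inj_on_def)
  have "poly (\<Prod>i<r. [:- x i, 1:]) (x r) \<noteq> 0"
  proof -
    have "x r \<noteq> x i" if "i < r" for i using inj_onD[OF Suc.prems(1), of r i] that by auto
    then show ?thesis by (auto simp: poly_prod)
  qed
  then have "poly q' (x r) = 0" using Suc.prems(2)[of r] q' by auto
  then obtain q'' where "q' = [:- x r, 1:] * q''" by (auto simp only: poly_eq_0_iff_dvd dvd_def)
  then have "q = (\<Prod>i<Suc r. [:- x i, 1:]) * q''" using q' by (simp only: prod.lessThan_Suc mult.assoc)
  then show ?case by blast
qed

text \<open>Any monic polynomials of degrees 0, ..., r-1 give the Vandermonde product.\<close>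

lemma det_ffpoly: "det (mat r r (\<lambda>(i,j). poly (ffpoly i) (x j))) = vandermonde r x"
proof (induction r)
  case 0
  then show ?case by (simp add: vandermonde_def)
next
  case (Suc r)
  show ?case
  proof (cases "inj_on x {..<Suc r}")
    case False
    then show ?thesis using det_repeated_column[OF False, of "\<lambda>i. poly (ffpoly i)"] vandermonde_nonzero_iff by auto
  next
    case True
    then have inj: "inj_on x {..<r}" by (auto simp: inj_on_def)
    obtain C where C: "\<And>X. det (mat (Suc r) (Suc r) (\<lambda>(i,j). poly (ffpoly i) (if j = r then X else x j))) = (\<Sum>i\<le>r. C i * poly (ffpoly i) X)"
      "\<And>i. i \<le> r \<Longrightarrow> C i = (-1) ^ (i + r) * det (mat r r (\<lambda>(i',j). poly (ffpoly (if i' < i then i' else Suc i')) (x j)))"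
      by (rule det_last_column[of r "\<lambda>i. poly (ffpoly i)" x]) blast
    have "mat r r (\<lambda>(i',j). poly (ffpoly (if i' < r then i' else Suc i')) (x j)) = mat r r (\<lambda>(i,j). poly (ffpoly i) (x j))"
      by (rule eq_matI) auto
    then have Cr: "C r = vandermonde r x" using C(2)[of r] Suc.IH by (simp add: power_add flip: power_mult_distrib)
    \<comment> \<open>Both summands have degree r in X with leading coefficient \<open>C r\<close>,
      and both vanish at the r earlier arguments. Their difference has degree below r and r roots,
      so it is 0.\<close>
    define Q where "Q = (\<Sum>i\<le>r. smult (C i) (ffpoly i)) - smult (C r) (\<Prod>i<r. [:- x i, 1:])"
    have "Q = 0"
    proof (rule ccontr)
      assume "Q \<noteq> 0"
      have m: "degree (\<Prod>i<r. [:- x i, 1:]) = r" "coeff (\<Prod>i<r. [:- x i, 1:]) r = 1" 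
        using monic_linear_prod[of "{..<r}" x] by auto
      have c: "coeff Q n = 0" if "n \<ge> r" for n
      proof -
        have *: "coeff (ffpoly i) n = (if i = n then 1 else 0)" if "i \<le> r" for i
          using that \<open>n \<ge> r\<close> degree_ffpoly by (cases "i = n") (auto intro!: coeff_eq_0)
        have "coeff Q n = (\<Sum>i\<le>r. C i * (if i = n then 1 else 0)) - C r * coeff (\<Prod>i<r. [:- x i, 1:]) n"
          unfolding Q_def by (simp add: coeff_sum *)
        also have "\<dots> = 0" 
        proof (cases "n = r")
          case True
          then show ?thesis using m(2) by (simp add: if_distrib sum.delta' cong: if_cong)
        next
          case False
          then have "coeff (\<Prod>i<r. [:- x i, 1:]) n = 0" using that m(1) by (intro coeff_eq_0) simp
          moreover have "(\<Sum>i\<le>r. C i * (if i = n then 1 else 0)) = 0"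
            using that False by (intro sum.neutral) auto
          ultimately show ?thesis by simp
        qed
        finally show ?thesis .
      qed
      have deg: "degree Q < r"
        using c[of "degree Q"] \<open>Q \<noteq> 0\<close> by (meson leI leading_coeff_0_iff)
      have van: "poly Q (x j) = 0" if "j < r" for j
      proof -
        have "\<not> inj_on (\<lambda>j'. if j' = r then x j else x j') {..<Suc r}"
          by (rule not_inj_on_override[OF that])
        from det_repeated_column[OF this, of "\<lambda>i. poly (ffpoly i)"] 
        have "(\<Sum>i\<le>r. C i * poly (ffpoly i) (x j)) = 0" using C(1)[of "x j"] by simp
        then show ?thesis using that by (auto simp: Q_def poly_sum poly_prod prod_zero_iff)
      qed
      have "x ` {..<r} \<subseteq> {y. poly Q y = 0}" using van by auto
      from card_mono[OF poly_roots_finite[OF \<open>Q \<noteq> 0\<close>] this]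
      have "r \<le> card {y. poly Q y = 0}" using card_image[OF inj] by simp
      then show False using card_poly_roots_bound[OF \<open>Q \<noteq> 0\<close>] deg by simp
    qed
    have "mat (Suc r) (Suc r) (\<lambda>(i,j). poly (ffpoly i) (if j = r then x r else x j)) = mat (Suc r) (Suc r) (\<lambda>(i,j). poly (ffpoly i) (x j))"
      by (rule eq_matI) auto
    then have "det (mat (Suc r) (Suc r) (\<lambda>(i,j). poly (ffpoly i) (x j))) = (\<Sum>i\<le>r. C i * poly (ffpoly i) (x r))"
      using C(1)[of "x r"] by simp
    also have "\<dots> = poly Q (x r) + C r * (\<Prod>i<r. x r - x i)"
      by (simp add: Q_def poly_sum poly_prod)
    also have "\<dots> = vandermonde (Suc r) x" using \<open>Q = 0\<close> Cr by (simp add: vandermonde_Suc)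
    finally show ?thesis .
  qed
qed

text \<open>Power series all of whose coefficients are integer polynomials in a parameter. That a determinant of such
families is divisible by the Vandermonde product is the reason why the Wronskian is divisible by \<open>\<Delta>\<close>.\<close>

definition poly_coeffs :: "(int \<Rightarrow> int fps) \<Rightarrow> bool" where
  "poly_coeffs \<phi> \<longleftrightarrow> (\<forall>k. \<exists>q. \<forall>n. fps_nth (\<phi> n) k = poly q n)"

lemma poly_coeffs_const: "poly_coeffs (\<lambda>_. c)"
  unfolding poly_coeffs_def by (intro allI exI[of _ "[:fps_nth c k:]" for k]) simp

lemma poly_coeffs_linear: "poly_coeffs (\<lambda>n. fps_const (n - c))"
  unfolding poly_coeffs_def
proof
  fix k show "\<exists>q. \<forall>n. fps_nth (fps_const (n - c)) k = poly q n"
    by (cases k) (auto intro: exI[of _ "[:-c, 1:]"] exI[of _ 0])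
qed

lemma poly_coeffs_mult: assumes "poly_coeffs \<phi>" "poly_coeffs \<psi>" shows "poly_coeffs (\<lambda>n. \<phi> n * \<psi> n)"
proof -
  obtain p q where "\<And>k n. fps_nth (\<phi> n) k = poly (p k) n" "\<And>k n. fps_nth (\<psi> n) k = poly (q k) n"
    using assms(1)[unfolded poly_coeffs_def, THEN choice] assms(2)[unfolded poly_coeffs_def, THEN choice] by auto
  then show ?thesis unfolding poly_coeffs_def fps_mult_nth
    by (intro allI exI[of _ "\<Sum>i=0..k. p i * q (k - i)" for k]) (simp add: poly_sum)
qed

lemma poly_coeffs_shift: assumes "poly_coeffs \<phi>" shows "poly_coeffs (\<lambda>n. \<phi> (n - c))"
proof -
  obtain p where "\<And>k n. fps_nth (\<phi> n) k = poly (p k) n"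
    using assms[unfolded poly_coeffs_def, THEN choice] by auto
  then show ?thesis unfolding poly_coeffs_def
    by (intro allI exI[of _ "pcompose (p k) [:-c, 1:]" for k]) (simp add: poly_pcompose)
qed

lemma poly_coeffs_prod: "finite I \<Longrightarrow> (\<And>i. i \<in> I \<Longrightarrow> poly_coeffs (\<phi> i)) \<Longrightarrow> poly_coeffs (\<lambda>n. \<Prod>i\<in>I. \<phi> i n)"
  by (induction I rule: finite_induct) (auto intro: poly_coeffs_const poly_coeffs_mult)

text \<open>By induction the minors contain the Vandermonde product of the first r arguments; after
  dividing by it, the k-th coefficient is an integer polynomial in the last argument, which vanishes
  at the earlier ones. F is arbitrary in the induction because every minor omits a different
  row.\<close>

lemma vandermonde_dvd_det:
  fixes x :: "nat \<Rightarrow> int"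
  assumes "\<And>i. i < r \<Longrightarrow> poly_coeffs (F i)"
  shows "vandermonde r x dvd fps_nth (det (mat r r (\<lambda>(i,j). F i (x j)))) k"
  using assms
proof (induction r arbitrary: F k)
  case 0
  then show ?case by (simp add: vandermonde_def)
next
  case (Suc r)
  show ?case
  proof (cases "inj_on x {..<Suc r}")
    case False
    then show ?thesis using det_repeated_column[OF False, of F] by simp
  next
    case True
    then have inj: "inj_on x {..<r}" by (auto simp: inj_on_def)
    obtain C where C: "\<And>X. det (mat (Suc r) (Suc r) (\<lambda>(i,j). F i (if j = r then X else x j))) = (\<Sum>i\<le>r. C i * F i X)"
      "\<And>i. i \<le> r \<Longrightarrow> C i = (-1) ^ (i + r) * det (mat r r (\<lambda>(i',j). F (if i' < i then i' else Suc i') (x j)))"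
      by (rule det_last_column[of r F x]) blast
    have "\<exists>c. fps_nth (C i) l = vandermonde r x * c" if "i \<le> r" for i l
    proof -
      have "vandermonde r x dvd fps_nth (det (mat r r (\<lambda>(i',j). F (if i' < i then i' else Suc i') (x j)))) l"
        by (rule Suc.IH) (use Suc.prems in auto)
      then have "vandermonde r x dvd fps_nth (C i) l" unfolding C(2)[OF that] by (cases "even (i + r)") simp_all
      then show ?thesis by (simp add: dvd_def)
    qed
    then obtain c where c: "\<And>i l. i \<le> r \<Longrightarrow> fps_nth (C i) l = vandermonde r x * c i l" by metis
    have "\<forall>i\<in>{..r}. \<exists>q. \<forall>l n. fps_nth (F i n) l = poly (q l) n"
    proof
      fix i assume "i \<in> {..r}"
      then have "\<forall>k. \<exists>q. \<forall>n. fps_nth (F i n) k = poly q n" using Suc.prems[of i] by (simp add: poly_coeffs_def)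
      from choice[OF this] show "\<exists>q. \<forall>l n. fps_nth (F i n) l = poly (q l) n" .
    qed
    from bchoice[OF this] obtain q where q: "\<And>i l n. i \<le> r \<Longrightarrow> fps_nth (F i n) l = poly (q i l) n"
      by auto
    define Q where "Q = (\<Sum>i\<le>r. \<Sum>l=0..k. smult (c i l) (q i (k - l)))"
    have det: "fps_nth (det (mat (Suc r) (Suc r) (\<lambda>(i,j). F i (if j = r then X else x j)))) k = vandermonde r x * poly Q X" for X
      unfolding C(1) Q_def by (simp add: fps_sum_nth fps_mult_nth c q poly_sum sum_distrib_left mult.assoc)
    have van: "poly Q (x j) = 0" if "j < r" for j
    proof -
      have "\<not> inj_on (\<lambda>j'. if j' = r then x j else x j') {..<Suc r}"
        by (rule not_inj_on_override[OF that])
      from det_repeated_column[OF this, of F] 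
      have "vandermonde r x * poly Q (x j) = 0" using det[of "x j"] by simp
      then show ?thesis using inj vandermonde_nonzero_iff by auto
    qed
    obtain Q' where Q': "Q = (\<Prod>i<r. [:- x i, 1:]) * Q'" using prod_roots_dvd[OF inj van] by blast
    have "mat (Suc r) (Suc r) (\<lambda>(i,j). F i (if j = r then x r else x j)) = mat (Suc r) (Suc r) (\<lambda>(i,j). F i (x j))"
      by (rule eq_matI) auto
    then have "fps_nth (det (mat (Suc r) (Suc r) (\<lambda>(i,j). F i (x j)))) k = vandermonde (Suc r) x * poly Q' (x r)"
      using det[of "x r"] by (simp add: Q' vandermonde_Suc poly_prod)
    then show ?thesis by simp
  qed
qed

subsection \<open>Coefficients of the Wronskian\<close>

lemma det_mat_columns:
  "det (mat r r (\<lambda>(i,j). f i j)) = (\<Sum>q | q permutes {..<r}. signof q * (\<Prod>j<r. f (q j) j))"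
proof -
  have "det (mat r r (\<lambda>(i,j). f i j)) = det (transpose_mat (mat r r (\<lambda>(i,j). f i j)))"
    by (rule det_transpose[symmetric]) auto
  also have "\<dots> = (\<Sum>q | q permutes {0..<r}. signof q * (\<Prod>j = 0..<r. transpose_mat (mat r r (\<lambda>(i,j). f i j)) $$ (j, q j)))"
    by (rule det_def') auto
  also have "\<dots> = (\<Sum>q | q permutes {..<r}. signof q * (\<Prod>j<r. f (q j) j))"
    unfolding lessThan_atLeast0
  proof (intro sum.cong refl arg_cong2[where f = "(*)"] prod.cong)
    fix q j assume "q \<in> {q. q permutes {0..<r}}" "j \<in> {0..<r}"
    then have "q j < r" "j < r" using permutes_in_image[of q "{0..<r}" j] by auto
    then show "transpose_mat (mat r r (\<lambda>(i,j). f i j)) $$ (j, q j) = f (q j) j" by simp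
  qed
  finally show ?thesis .
qed

section \<open>Hermite coefficients, derivatives and the expansion of the Wronskian\<close>

lemma degree_herm: "degree (herm n) = n" "coeff (herm n) n = 1"
proof -
  have "degree (herm n) = n \<and> lead_coeff (herm n) = 1"
  proof (induction n rule: herm.induct)
    case (3 k)
    have h: "herm (Suc k) \<noteq> 0" using 3 by auto
    have d1: "degree ([:0, 1:] * herm (Suc k)) = Suc (Suc k)" using 3 h by (subst degree_mult_eq) auto
    have d2: "degree (smult (int (Suc k)) (herm k)) < degree ([:0, 1:] * herm (Suc k))" 
      unfolding d1 using 3 by (intro le_less_trans[OF degree_smult_le]) auto
    have "degree (herm (Suc (Suc k))) = Suc (Suc k)"
      using degree_add_eq_left[of "- smult (int (Suc k)) (herm k)" "[:0, 1:] * herm (Suc k)"] d1 d2 by simp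
    moreover have "lead_coeff (herm (Suc (Suc k))) = lead_coeff ([:0, 1:] * herm (Suc k))"
      using lead_coeff_add_le[of "- smult (int (Suc k)) (herm k)" "[:0, 1:] * herm (Suc k)"] d2 by simp
    moreover have "lead_coeff (herm (Suc k)) = 1" using 3 by blast
    then have "lead_coeff ([:0, 1:] * herm (Suc k)) = lead_coeff [:0, 1::int:] * 1" by (simp only: lead_coeff_mult)
    ultimately show ?case by simp
  qed simp_all
  then show "degree (herm n) = n" "coeff (herm n) n = 1" by auto
qed

lemma coeff_herm_rec:
  "coeff (herm (Suc (Suc n))) t = (if t = 0 then 0 else coeff (herm (Suc n)) (t - 1)) - int (Suc n) * coeff (herm n) t"
  by (cases t) simp_all

lemma coeff_herm_odd: "odd (n + t) \<Longrightarrow> coeff (herm n) t = 0"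
proof (induction n arbitrary: t rule: herm.induct)
  case 2
  then show ?case by (cases t) (auto simp: coeff_pCons odd_pos split: nat.splits)
next
  case (3 k)
  then show ?case unfolding coeff_herm_rec by (cases t) auto
qed (auto simp: odd_pos)

lemma coeff_herm_above: "t > n \<Longrightarrow> coeff (herm n) t = 0"
  by (intro coeff_eq_0) (simp add: degree_herm)

text \<open>The explicit coefficient (-1)^k n!/(k! 2^k m!) with denominators cleared. In the
  recurrence one term has the same k and smaller m, the other the same m and smaller k.\<close>

lemma coeff_herm: "coeff (herm (m + 2 * k)) m * (fact k * 2 ^ k * fact m) = (-1) ^ k * fact (m + 2 * k)"
proof (induction "m + 2 * k" arbitrary: m k rule: less_induct)
  case less
  show ?case
  proof (cases k)
    case 0
    then show ?thesis by (simp add: degree_herm)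
  next
    case (Suc k')
    define N where "N = m + 2 * k'"
    have N: "m + 2 * k = Suc (Suc N)" using Suc by (simp add: N_def)
    have 1: "coeff (herm N) m * (fact k' * 2 ^ k' * fact m) = (-1) ^ k' * fact N"
      using less[of m k'] Suc by (simp add: N_def)
    have 2: "(if m = 0 then 0 else coeff (herm (Suc N)) (m - 1)) * (fact k * 2 ^ k * fact m) = int m * ((-1) ^ k * fact (Suc N))"
    proof (cases m)
      case (Suc m')
      have "Suc N = m' + 2 * k" using N Suc by simp
      then have "coeff (herm (Suc N)) m' * (fact k * 2 ^ k * fact m') = (-1) ^ k * fact (Suc N)"
        using less[of m' k] Suc by simp
      moreover have "fact m = int m * fact m'" using Suc by simp
      ultimately show ?thesis using Suc by (simp del: fact_Suc add: mult_ac)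
    qed simp
    have fk: "fact k * 2 ^ k = 2 * int k * (fact k' * 2 ^ k')" using Suc by simp
    have "int (Suc N) * coeff (herm N) m * (fact k * 2 ^ k * fact m) = int (Suc N) * (2 * int k) * (coeff (herm N) m * (fact k' * 2 ^ k' * fact m))"
      unfolding fk by (simp only: mult_ac)
    also have "\<dots> = 2 * int k * ((-1) ^ k' * fact (Suc N))" unfolding 1 fact_Suc by (simp only: of_nat_mult mult_ac of_nat_id)
    finally have 3: "int (Suc N) * coeff (herm N) m * (fact k * 2 ^ k * fact m) = 2 * int k * ((-1) ^ k' * fact (Suc N))" .
    have "coeff (herm (m + 2 * k)) m * (fact k * 2 ^ k * fact m) = 
      int m * ((-1) ^ k * fact (Suc N)) - 2 * int k * ((-1) ^ k' * fact (Suc N))"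
      unfolding N coeff_herm_rec left_diff_distrib 2 3 ..
    also have "\<dots> = int (m + 2 * k) * ((-1) ^ k * fact (Suc N))" using Suc by (simp add: algebra_simps)
    also have "\<dots> = (-1) ^ k * fact (m + 2 * k)" unfolding N fact_Suc[of "Suc N"] by (simp only: mult_ac of_nat_id)
    finally show ?thesis .
  qed
qed

lemma pderiv_herm: "pderiv (herm (Suc n)) = smult (int (Suc n)) (herm n)"
proof (induction n rule: herm.induct)
  case 1
  then show ?case by (simp add: pderiv_pCons)
next
  case 2
  then show ?case by (simp add: pderiv_pCons pderiv_diff pderiv_smult)
next
  case (3 k)
  have "pderiv (herm (Suc (Suc (Suc k)))) = herm (Suc (Suc k)) + [:0, 1:] * pderiv (herm (Suc (Suc k))) - smult (int (Suc (Suc k))) (pderiv (herm (Suc k)))"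
    by (simp only: herm.simps(3)[of "Suc k"] pderiv_diff pderiv_mult pderiv_smult) (simp add: pderiv_pCons)
  also have "\<dots> = herm (Suc (Suc k)) + smult (int (Suc (Suc k))) ([:0, 1:] * herm (Suc k) - smult (int (Suc k)) (herm k))"
    unfolding 3 by (simp add: smult_diff_right mult.commute)
  also have "\<dots> = herm (Suc (Suc k)) + smult (int (Suc (Suc k))) (herm (Suc (Suc k)))" by (simp only: herm.simps(3))
  also have "\<dots> = smult (int (Suc (Suc (Suc k)))) (herm (Suc (Suc k)))" 
    by (metis add.commute add.left_neutral of_nat_Suc smult_1_left smult_add_left)
  finally show ?case .
qed

lemma poly_ffpoly_eq_0: "m < i \<Longrightarrow> poly (ffpoly i) (int m) = 0"
  unfolding ffpoly_def by (auto simp: poly_prod)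

text \<open>Truncated subtraction does no harm: once m < i the falling factorial already
  vanishes.\<close>

lemma poly_ffpoly_Suc_diff: "poly (ffpoly (Suc i)) (int m) = int (m - i) * poly (ffpoly i) (int m)"
  by (cases "m < i") (auto simp: ffpoly_Suc poly_ffpoly_eq_0 of_nat_diff left_diff_distrib)

lemma higher_pderiv_herm: "(pderiv ^^ i) (herm n) = smult (poly (ffpoly i) (int n)) (herm (n - i))"
proof (induction i)
  case (Suc i)
  have "pderiv (herm (n - i)) = smult (int (n - i)) (herm (n - Suc i))"
    using pderiv_herm[of "n - Suc i"] by (cases "i < n") (auto simp: Suc_diff_Suc)
  then show ?case by (simp only: funpow.simps o_def Suc pderiv_smult smult_smult poly_ffpoly_Suc_diff mult.commute)
qed simp

lemma higher_pderiv_monom_ffpoly: "(pderiv ^^ i) (monom c m) = monom (poly (ffpoly i) (int m) * c) (m - i)"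
proof (induction i)
  case (Suc i)
  then show ?case by (simp add: pderiv_monom poly_ffpoly_Suc_diff mult.assoc)
qed simp

lemma prod_monom: "finite A \<Longrightarrow> (\<Prod>j\<in>A. monom (a j) (e j)) = monom (\<Prod>j\<in>A. a j) (\<Sum>j\<in>A. e j)"
  by (induction A rule: finite_induct) (auto simp: mult_monom monom_0 simp flip: one_pCons)

lemma coeff_signof_mult: "coeff (signof q * f) t = signof q * coeff f t"
  by (simp add: sign_def)

text \<open>The Wronskian of the monomials x^(mu_j) is Delta(mu) x^(sum mu - binom(r,2)). The bound
  B only makes the index set finite; it stays free so that it can also cover the entries of the
  core.\<close>

lemma coeff_wronskian_herm:
  assumes "\<And>j. j < length ns \<Longrightarrow> ns ! j \<le> B"
  defines "r \<equiv> length ns"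
  shows "coeff (wronskian (map herm ns)) t = 
    (\<Sum>\<mu> | \<mu> \<in> PiE {..<r} (\<lambda>_. {..B}) \<and> (\<Sum>j<r. \<mu> j) = t + (r choose 2). 
       (\<Prod>j<r. coeff (herm (ns ! j)) (\<mu> j)) * vandermonde r (\<lambda>j. int (\<mu> j)))"
proof -
  let ?c = "\<lambda>j m. coeff (herm (ns ! j)) m"
  let ?P = "PiE {..<r} (\<lambda>_. {..B})"
  have "mat r r (\<lambda>(i,j). (pderiv ^^ i) (map herm ns ! j)) = mat r r (\<lambda>(i,j). (pderiv ^^ i) (herm (ns ! j)))"
    by (rule eq_matI) (auto simp: r_def)
  then have "wronskian (map herm ns) = det (mat r r (\<lambda>(i,j). (pderiv ^^ i) (herm (ns ! j))))"
    unfolding wronskian_def r_def by simp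
  also have "\<dots> = (\<Sum>q | q permutes {..<r}. signof q * (\<Prod>j<r. (pderiv ^^ q j) (herm (ns ! j))))"
    by (rule det_mat_columns)
  finally have W: "wronskian (map herm ns) = \<dots>" .
  have D: "(pderiv ^^ i) (herm (ns ! j)) = (\<Sum>m\<le>B. monom (poly (ffpoly i) (int m) * ?c j m) (m - i))" if "j < r" for i j
  proof -
    have "herm (ns ! j) = (\<Sum>m\<le>B. monom (?c j m) m)"
      by (rule poly_as_sum_of_monoms'[symmetric]) (use assms that in \<open>simp add: degree_herm\<close>)
    then have "(pderiv ^^ i) (herm (ns ! j)) = (pderiv ^^ i) (\<Sum>m\<le>B. monom (?c j m) m)" by simp
    then show ?thesis by (simp only: higher_pderiv_sum higher_pderiv_monom_ffpoly)
  qed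
  have T: "coeff (\<Prod>j<r. (pderiv ^^ q j) (herm (ns ! j))) t = 
     (\<Sum>\<mu> | \<mu> \<in> ?P \<and> (\<Sum>j<r. \<mu> j) = t + (r choose 2). (\<Prod>j<r. ?c j (\<mu> j)) * (\<Prod>j<r. poly (ffpoly (q j)) (int (\<mu> j))))"
    if q: "q permutes {..<r}" for q
  proof -
    have "(\<Prod>j<r. (pderiv ^^ q j) (herm (ns ! j))) = (\<Prod>j<r. \<Sum>m\<le>B. monom (poly (ffpoly (q j)) (int m) * ?c j m) (m - q j))"
      by (intro prod.cong refl) (simp only: D lessThan_iff)
    also have "\<dots> = (\<Sum>\<mu>\<in>?P. \<Prod>j<r. monom (poly (ffpoly (q j)) (int (\<mu> j)) * ?c j (\<mu> j)) (\<mu> j - q j))"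
      by (rule prod_sum_PiE) auto
    also have "\<dots> = (\<Sum>\<mu>\<in>?P. monom (\<Prod>j<r. poly (ffpoly (q j)) (int (\<mu> j)) * ?c j (\<mu> j)) (\<Sum>j<r. \<mu> j - q j))"
      by (simp add: prod_monom)
    finally have "coeff (\<Prod>j<r. (pderiv ^^ q j) (herm (ns ! j))) t = 
      (\<Sum>\<mu>\<in>?P. if (\<Sum>j<r. \<mu> j - q j) = t then (\<Prod>j<r. poly (ffpoly (q j)) (int (\<mu> j)) * ?c j (\<mu> j)) else 0)"
      by (simp add: coeff_sum)
    also have "\<dots> = (\<Sum>\<mu>\<in>?P. if (\<Sum>j<r. \<mu> j) = t + (r choose 2) then (\<Prod>j<r. ?c j (\<mu> j)) * (\<Prod>j<r. poly (ffpoly (q j)) (int (\<mu> j))) else 0)"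
    proof (rule sum.cong[OF refl])
      fix \<mu> assume "\<mu> \<in> ?P"
      show "(if (\<Sum>j<r. \<mu> j - q j) = t then (\<Prod>j<r. poly (ffpoly (q j)) (int (\<mu> j)) * ?c j (\<mu> j)) else 0) =
        (if (\<Sum>j<r. \<mu> j) = t + (r choose 2) then (\<Prod>j<r. ?c j (\<mu> j)) * (\<Prod>j<r. poly (ffpoly (q j)) (int (\<mu> j))) else 0)"
      \<comment> \<open>Where a truncated exponent would be wrong, the falling factorial makes the
        term 0.\<close>
      proof (cases "\<exists>j<r. \<mu> j < q j")
        case True
        then have "(\<Prod>j<r. poly (ffpoly (q j)) (int (\<mu> j))) = 0"
          using poly_ffpoly_eq_0 by (auto simp: prod_zero_iff)
        then show ?thesis by (simp add: prod.distrib)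
      next
        case False
        have "(\<Sum>j<r. \<mu> j) = (\<Sum>j<r. (\<mu> j - q j) + q j)" using False by (intro sum.cong) auto
        also have "\<dots> = (\<Sum>j<r. \<mu> j - q j) + (\<Sum>j<r. q j)" by (rule sum.distrib)
        also have "(\<Sum>j<r. q j) = (r choose 2)"
          using sum.permute[OF q, of "\<lambda>j. j"] by (simp add: sum_lessThan_choose o_def)
        finally show ?thesis by (simp add: prod.distrib mult.commute)
      qed
    qed
    also have "\<dots> = (\<Sum>\<mu> | \<mu> \<in> ?P \<and> (\<Sum>j<r. \<mu> j) = t + (r choose 2). (\<Prod>j<r. ?c j (\<mu> j)) * (\<Prod>j<r. poly (ffpoly (q j)) (int (\<mu> j))))"
      by (subst sum.inter_filter[symmetric]) (auto intro!: finite_PiE)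
    finally show ?thesis .
  qed
  have "coeff (wronskian (map herm ns)) t = (\<Sum>q | q permutes {..<r}. signof q * coeff (\<Prod>j<r. (pderiv ^^ q j) (herm (ns ! j))) t)"
    unfolding W coeff_sum coeff_signof_mult ..
  also have "\<dots> = (\<Sum>q | q permutes {..<r}. \<Sum>\<mu> | \<mu> \<in> ?P \<and> (\<Sum>j<r. \<mu> j) = t + (r choose 2).
      (\<Prod>j<r. ?c j (\<mu> j)) * (signof q * (\<Prod>j<r. poly (ffpoly (q j)) (int (\<mu> j)))))"
    by (intro sum.cong refl) (simp add: T sum_distrib_left mult_ac)
  also have "\<dots> = (\<Sum>\<mu> | \<mu> \<in> ?P \<and> (\<Sum>j<r. \<mu> j) = t + (r choose 2). (\<Prod>j<r. ?c j (\<mu> j)) * 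
      (\<Sum>q | q permutes {..<r}. signof q * (\<Prod>j<r. poly (ffpoly (q j)) (int (\<mu> j)))))"
    by (subst sum.swap) (simp only: sum_distrib_left)
  also have "\<dots> = (\<Sum>\<mu> | \<mu> \<in> ?P \<and> (\<Sum>j<r. \<mu> j) = t + (r choose 2). (\<Prod>j<r. ?c j (\<mu> j)) * vandermonde r (\<lambda>j. int (\<mu> j)))"
    using det_mat_columns[of r "\<lambda>i j. poly (ffpoly i) (int (\<mu> j))" for \<mu>] det_ffpoly[of r "\<lambda>j. int (\<mu> j)" for \<mu>]
    by simp
  finally show ?thesis .
qed

text \<open>The reversed polynomials satisfy \<open>h\<^sub>n\<^sub>-\<^sub>1 = \<rho>\<^sub>n h\<^sub>n\<close> with the continued fraction
\<open>\<rho>\<^sub>n = 1 / (1 - (n - 1) y\<^sup>2 \<rho>\<^sub>n\<^sub>-\<^sub>1)\<close>, whose coefficients are therefore integer polynomials in \<open>n\<close>.\<close>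

fun ratio_poly :: "nat \<Rightarrow> int poly" where
  "ratio_poly 0 = 1"
| "ratio_poly (Suc 0) = 0"
| "ratio_poly (Suc (Suc k)) = [:-1, 1:] * (\<Sum>i\<le>k. pcompose (ratio_poly i) [:-1, 1:] * ratio_poly (k - i))"

definition ratio :: "int \<Rightarrow> int fps" where "ratio x = Abs_fps (\<lambda>k. poly (ratio_poly k) x)"

lemma poly_coeffs_ratio: "poly_coeffs ratio"
  unfolding poly_coeffs_def ratio_def by auto

lemma ratio_eq: "ratio x = 1 + fps_const (x - 1) * (fps_X ^ 2 * (ratio (x - 1) * ratio x))"
proof (rule fps_ext)
  fix k
  consider "k = 0" | "k = 1" | k' where "k = Suc (Suc k')" by (cases k rule: ratio_poly.cases) auto
  then show "fps_nth (ratio x) k = fps_nth (1 + fps_const (x - 1) * (fps_X ^ 2 * (ratio (x - 1) * ratio x))) k"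
  proof cases
    case 3
    have "fps_nth (fps_X ^ 2 * (ratio (x - 1) * ratio x)) k = (\<Sum>i\<le>k'. poly (ratio_poly i) (x - 1) * poly (ratio_poly (k' - i)) x)"
      unfolding 3 by (simp add: fps_X_power_mult_nth del: power_Suc) (simp add: fps_mult_nth ratio_def atLeast0AtMost)
    then show ?thesis unfolding 3 by (simp add: ratio_def poly_sum poly_pcompose algebra_simps)
  qed (simp_all add: ratio_def fps_X_power_mult_nth)
qed

section \<open>Reversed Hermite polynomials and divisibility by Delta\<close>

definition rev_herm :: "nat \<Rightarrow> int fps" where "rev_herm n = fps_of_poly (reflect_poly (herm n))"

lemma rev_herm_nth: "fps_nth (rev_herm n) k = (if k \<le> n then coeff (herm n) (n - k) else 0)"
  by (simp add: rev_herm_def coeff_reflect_poly degree_herm)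

lemma rev_herm_rec: "rev_herm (Suc (Suc n)) = rev_herm (Suc n) - fps_const (int (Suc n)) * (fps_X ^ 2 * rev_herm n)"
proof (rule fps_ext)
  fix k
  show "fps_nth (rev_herm (Suc (Suc n))) k = fps_nth (rev_herm (Suc n) - fps_const (int (Suc n)) * (fps_X ^ 2 * rev_herm n)) k"
  proof (cases "k \<le> Suc (Suc n)")
    case False
    then show ?thesis by (simp add: rev_herm_nth fps_X_power_mult_nth)
  next
    case True
    have 1: "(if Suc (Suc n) - k = 0 then 0 else coeff (herm (Suc n)) (Suc (Suc n) - k - 1)) = fps_nth (rev_herm (Suc n)) k"
      using True by (auto simp: rev_herm_nth Suc_diff_le)
    have "n - (k - 2) = Suc (Suc n) - k" if "\<not> k < 2" using that True by simp
    then have 2: "coeff (herm n) (Suc (Suc n) - k) = fps_nth (fps_X ^ 2 * rev_herm n) k"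
      using True by (auto simp: rev_herm_nth fps_X_power_mult_nth intro!: coeff_herm_above)
    have "fps_nth (rev_herm (Suc (Suc n))) k = coeff (herm (Suc (Suc n))) (Suc (Suc n) - k)" using True by (simp only: rev_herm_nth if_True)
    also have "\<dots> = fps_nth (rev_herm (Suc n)) k - int (Suc n) * fps_nth (fps_X ^ 2 * rev_herm n) k"
      unfolding coeff_herm_rec 1 2 ..
    finally show ?thesis by simp
  qed
qed

lemma ratio_rev_herm: "ratio (int (Suc n)) * rev_herm (Suc n) = rev_herm n"
proof (induction n)
  case 0
  have "ratio 1 = 1" using ratio_eq[of 1] by simp
  moreover have "rev_herm (Suc 0) = rev_herm 0"
    by (rule fps_ext) (auto simp: rev_herm_nth coeff_pCons split: nat.splits)
  ultimately show ?case by simp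
next
  case (Suc n)
  define R where "R = ratio (int (Suc (Suc n)))"
  define S where "S = fps_const (int (Suc n)) * (fps_X ^ 2 * ratio (int (Suc n)))"
  have "R = 1 + S * R" using ratio_eq[of "int (Suc (Suc n))"] by (simp add: R_def S_def mult.assoc)
  then have R: "R * (1 - S) = 1" by (simp add: algebra_simps)
  have "rev_herm (Suc (Suc n)) = rev_herm (Suc n) - fps_const (int (Suc n)) * (fps_X ^ 2 * (ratio (int (Suc n)) * rev_herm (Suc n)))"
    unfolding Suc rev_herm_rec ..
  also have "\<dots> = (1 - S) * rev_herm (Suc n)" unfolding S_def by (simp only: left_diff_distrib mult.assoc mult_1_left)
  finally have "R * rev_herm (Suc (Suc n)) = R * (1 - S) * rev_herm (Suc n)" by (simp only: mult.assoc)
  then show ?case unfolding R by (simp add: R_def)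
qed

text \<open>The reversed i-th derivative of He_x divided by the reversed He_x. Taking the reversed
  He_(n_j) out of column j leaves a determinant of these families, to which
  \<open>vandermonde_dvd_det\<close> applies.\<close>

definition deriv_ratio :: "nat \<Rightarrow> int \<Rightarrow> int fps" where
  "deriv_ratio i x = (\<Prod>l<i. fps_const (x - int l) * ratio (x - int l))"

lemma poly_coeffs_deriv_ratio: "poly_coeffs (deriv_ratio i)"
  unfolding deriv_ratio_def
  by (intro poly_coeffs_prod poly_coeffs_mult poly_coeffs_linear poly_coeffs_shift poly_coeffs_ratio) auto

lemma deriv_ratio_rev_herm: "deriv_ratio i (int n) * rev_herm n = fps_const (poly (ffpoly i) (int n)) * rev_herm (n - i)"
proof (induction i)
  case (Suc i)
  have "deriv_ratio (Suc i) (int n) * rev_herm n = (fps_const (int n - int i) * ratio (int n - int i)) * (deriv_ratio i (int n) * rev_herm n)"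
    by (simp add: deriv_ratio_def mult_ac)
  also have "\<dots> = fps_const (int n - int i) * fps_const (poly (ffpoly i) (int n)) * (ratio (int n - int i) * rev_herm (n - i))"
    unfolding Suc by (simp only: mult_ac)
  also have "\<dots> = fps_const (poly (ffpoly (Suc i)) (int n)) * rev_herm (n - Suc i)"
  proof (cases "i < n")
    case True
    then have "ratio (int n - int i) * rev_herm (n - i) = rev_herm (n - Suc i)"
      using ratio_rev_herm[of "n - Suc i"] by (simp add: Suc_diff_Suc of_nat_diff)
    then show ?thesis by (simp add: ffpoly_Suc left_diff_distrib)
  next
    \<comment> \<open>For i >= n the truncated index n - i is 0 and no ratio identity is available,
      but the falling factor vanishes.\<close>
    case False
    then have "int n = int i \<or> n < i" by auto
    then have "(int n - int i) * poly (ffpoly i) (int n) = 0" by (auto simp: poly_ffpoly_eq_0)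
    then show ?thesis by (simp add: ffpoly_Suc left_diff_distrib)
  qed
  finally show ?case .
qed (simp add: deriv_ratio_def)

lemma signof_fps_nth: "fps_nth (signof q * f) k = signof q * fps_nth f k"
  by (simp add: sign_def)

text \<open>Without this, \<open>div\<close> in \<open>He_part\<close> could round. The determinant
  is reversed term by term, which is possible because all its nonzero terms have the same
  degree.\<close>

lemma Delta_dvd_coeff_wronskian: "Delta ns dvd coeff (wronskian (map herm ns)) t"
proof -
  define r where "r = length ns"
  define n where "n j = ns ! j" for j
  \<comment> \<open>The common degree of the nonzero terms: differentiation lowers the total by 0 +
    1 + ... + (r-1).\<close>
  define M where "M = (\<Sum>j<r. n j) - (r choose 2)"
  have "mat r r (\<lambda>(i,j). (pderiv ^^ i) (map herm ns ! j)) = mat r r (\<lambda>(i,j). (pderiv ^^ i) (herm (n j)))"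
    by (rule eq_matI) (auto simp: r_def n_def)
  then have "wronskian (map herm ns) = det (mat r r (\<lambda>(i,j). (pderiv ^^ i) (herm (n j))))"
    unfolding wronskian_def r_def by simp
  then have W: "wronskian (map herm ns) = (\<Sum>q | q permutes {..<r}. signof q * (\<Prod>j<r. (pderiv ^^ q j) (herm (n j))))"
    by (simp only: det_mat_columns)
  have T: "coeff (\<Prod>j<r. (pderiv ^^ q j) (herm (n j))) t = 
    (if t \<le> M then fps_nth (\<Prod>j<r. deriv_ratio (q j) (int (n j)) * rev_herm (n j)) (M - t) else 0)" 
    if q: "q permutes {..<r}" for q
  proof -
    have L: "(\<Prod>j<r. (pderiv ^^ q j) (herm (n j))) = smult (\<Prod>j<r. poly (ffpoly (q j)) (int (n j))) (\<Prod>j<r. herm (n j - q j))"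
      by (simp add: higher_pderiv_herm prod_smult)
    have R: "(\<Prod>j<r. deriv_ratio (q j) (int (n j)) * rev_herm (n j)) = 
        fps_const (\<Prod>j<r. poly (ffpoly (q j)) (int (n j))) * (\<Prod>j<r. rev_herm (n j - q j))"
    proof -
      have "(\<Prod>j<r. fps_const (f j)) = fps_const (\<Prod>j<r. f j)" for f :: "nat \<Rightarrow> int" by (induction r) simp_all
      then show ?thesis by (simp add: deriv_ratio_rev_herm prod.distrib)
    qed
    show ?thesis
    proof (cases "\<exists>j<r. n j < q j")
      case True
      then have "(\<Prod>j<r. poly (ffpoly (q j)) (int (n j))) = 0"
        using poly_ffpoly_eq_0 by (auto simp: prod_zero_iff)
      then show ?thesis unfolding L R by simp
    next
      case False
      have "(\<Sum>j<r. n j) = (\<Sum>j<r. (n j - q j) + q j)" using False by (intro sum.cong) auto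
      also have "\<dots> = (\<Sum>j<r. n j - q j) + (\<Sum>j<r. q j)" by (rule sum.distrib)
      also have "(\<Sum>j<r. q j) = (r choose 2)"
        using sum.permute[OF q, of "\<lambda>j. j"] by (simp add: sum_lessThan_choose o_def)
      finally have M: "M = (\<Sum>j<r. n j - q j)" by (simp add: M_def)
      define p where "p = (\<Prod>j<r. herm (n j - q j))"
      have nz: "herm m \<noteq> 0" for m using degree_herm(2)[of m] by auto
      have dp: "degree p = M" unfolding p_def M by (subst degree_prod_eq_sum_degree) (auto simp: nz degree_herm)
      have "(\<Prod>j<r. rev_herm (n j - q j)) = fps_of_poly (reflect_poly p)"
        by (simp add: rev_herm_def p_def fps_of_poly_prod reflect_poly_prod)
      then have "fps_nth (\<Prod>j<r. rev_herm (n j - q j)) (M - t) = coeff p t" if "t \<le> M"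
        using that by (simp add: coeff_reflect_poly dp)
      moreover have "coeff p t = 0" if "\<not> t \<le> M" using that dp by (intro coeff_eq_0) simp
      ultimately show ?thesis unfolding L R by (simp add: p_def)
    qed
  qed
  have "Delta ns = vandermonde r (\<lambda>j. int (n j))" by (simp add: Delta_vandermonde r_def n_def)
  moreover have "vandermonde r (\<lambda>j. int (n j)) dvd coeff (wronskian (map herm ns)) t"
  proof (cases "t \<le> M")
    case False
    then show ?thesis unfolding W by (simp add: coeff_sum coeff_signof_mult T)
  next
    case True
    have "coeff (wronskian (map herm ns)) t = fps_nth (\<Sum>q | q permutes {..<r}. signof q * (\<Prod>j<r. deriv_ratio (q j) (int (n j)) * rev_herm (n j))) (M - t)"
      unfolding W coeff_sum coeff_signof_mult fps_sum_nth signof_fps_nth using True by (simp add: T)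
    also have "(\<Sum>q | q permutes {..<r}. signof q * (\<Prod>j<r. deriv_ratio (q j) (int (n j)) * rev_herm (n j))) = 
       det (mat r r (\<lambda>(i,j). deriv_ratio i (int (n j)))) * (\<Prod>j<r. rev_herm (n j))"
      unfolding det_mat_columns[of r "\<lambda>i j. deriv_ratio i (int (n j))"] by (simp add: prod.distrib sum_distrib_right mult.assoc)
    finally have "coeff (wronskian (map herm ns)) t = (\<Sum>i=0..M - t. fps_nth (det (mat r r (\<lambda>(i,j). deriv_ratio i (int (n j))))) i * fps_nth (\<Prod>j<r. rev_herm (n j)) (M - t - i))"
      by (simp only: fps_mult_nth)
    also have "vandermonde r (\<lambda>j. int (n j)) dvd \<dots>"
      using vandermonde_dvd_det[of r deriv_ratio "\<lambda>j. int (n j)"] poly_coeffs_deriv_ratio by (intro dvd_sum dvd_mult2) auto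
    finally show ?thesis .
  qed
  ultimately show ?thesis by simp
qed

subsection \<open>Two-cores and Newton slopes\<close>

text \<open>Closed form for the end of all chains of 2-hook removals: within each parity the entries
  slide down to the smallest values. \<open>is_two_core_of_imp\<close> shows that every terminal set
  has this form, which makes the \<open>THE\<close> in \<open>two_core_size\<close>
  meaningful.\<close>

definition core :: "nat set \<Rightarrow> nat set" where
  "core A = {x. x div 2 < card (slice 2 A (x mod 2))}"

lemma slice_core: "j < 2 \<Longrightarrow> slice 2 (core A) j = {..<card (slice 2 A j)}"
  by (auto simp: slice_def core_def)

lemma finite_core: "finite (core A)"
proof (rule finite_subset)
  show "core A \<subseteq> {..<2 * (card (slice 2 A 0) + card (slice 2 A 1))}"
  proof
    fix x assume "x \<in> core A"
    then have "x div 2 < card (slice 2 A 0) + card (slice 2 A 1)"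
      unfolding core_def by (cases "x mod 2 = 0") auto
    then show "x \<in> {..<2 * (card (slice 2 A 0) + card (slice 2 A 1))}" by auto
  qed
qed simp

lemma slices_eqI:
  assumes "slice 2 A 0 = slice 2 B 0" "slice 2 A 1 = slice 2 B 1"
  shows "A = B"
proof (rule Set.set_eqI)
  fix x
  have "x \<in> C \<longleftrightarrow> x div 2 \<in> slice 2 C (x mod 2)" for C by (simp add: slice_def)
  moreover have "slice 2 A (x mod 2) = slice 2 B (x mod 2)" using assms by (cases "x mod 2 = 0") auto
  ultimately show "x \<in> A \<longleftrightarrow> x \<in> B" by blast
qed

lemma core_card_alt_sum:
  assumes "finite A"
  shows "card (core A) = card A" "alt_sum (core A) = alt_sum A" "2 * int (beta_size (core A)) = alt_sum A * (alt_sum A - 1)"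
proof -
  note 1 = card_alt_sum_slices[OF assms] and 2 = card_alt_sum_slices[OF finite_core[of A]]
  show "card (core A) = card A" using 1(1) 2(1) by (simp add: slice_core)
  show d: "alt_sum (core A) = alt_sum A" using 1(2) 2(2) by (simp add: slice_core)
  have "beta_size {..<n} = 0" for n by (simp add: beta_size_def sum_lessThan_choose)
  then show "2 * int (beta_size (core A)) = alt_sum A * (alt_sum A - 1)" using beta_size_ge_core[OF finite_core[of A]] d
    by (simp add: slice_core)
qed

lemma core_cong:
  assumes "finite A" "finite B" "card A = card B" "alt_sum A = alt_sum B"
  shows "core A = core B"
proof -
  have "card (slice 2 A 0) = card (slice 2 B 0)" "card (slice 2 A 1) = card (slice 2 B 1)"
    using card_alt_sum_slices[OF assms(1)] card_alt_sum_slices[OF assms(2)] assms(3,4) by linarith+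
  then show ?thesis by (intro slices_eqI[of "core A" "core B"]) (simp_all add: slice_core)
qed

lemma beta_size_core_le: 
  assumes "finite A"
  shows "beta_size (core A) \<le> beta_size A"
proof -
  have "2 * int (beta_size (core A)) \<le> 2 * int (beta_size A)"
    unfolding core_card_alt_sum(3)[OF assms] beta_size_ge_core[OF assms] by simp
  then show ?thesis by simp
qed

text \<open>The core is the only set of minimal size with its parity counts: by the size formula
  both parts of the 2-quotient are empty partitions. This is why only arrangements of the core reach
  the lowest coefficient.\<close>

lemma eq_core_if_beta_size: 
  assumes A: "finite A" and s: "beta_size A = beta_size (core A)"
  shows "A = core A"
proof -
  have fs: "finite (slice 2 A j)" for j by (rule finite_slice[OF A]) simp
  have z: "beta_size (slice 2 A 0) = 0" "beta_size (slice 2 A 1) = 0"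
  proof -
    have "4 * int (beta_size (slice 2 A 0)) + 4 * int (beta_size (slice 2 A 1)) = 0"
      using core_card_alt_sum(3)[OF A] beta_size_ge_core[OF A] by (simp add: s)
    then show "beta_size (slice 2 A 0) = 0" "beta_size (slice 2 A 1) = 0" by simp_all
  qed
  have *: "slice 2 A j = {..<card (slice 2 A j)}" if "beta_size (slice 2 A j) = 0" for j
    by (intro sum_ge_choose[OF fs, THEN conjunct2, rule_format]) (simp add: sum_beta_size[OF fs, of j] that)
  show ?thesis
  proof (rule slices_eqI)
    show "slice 2 A 0 = slice 2 (core A) 0" by (rule trans[OF *[OF z(1)] slice_core[symmetric]]) simp
    show "slice 2 A 1 = slice 2 (core A) 1" by (rule trans[OF *[OF z(2)] slice_core[symmetric]]) simp
  qed
qed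

lemma hook2_step_props:
  assumes "hook2_step A B" "finite A"
  shows "finite B" "card B = card A" "alt_sum B = alt_sum A" "\<Sum>B < \<Sum>A"
proof -
  obtain a where a: "a \<in> A" "a \<ge> 2" "a - 2 \<notin> A" and B: "B = insert (a - 2) (A - {a})"
    using assms by (auto simp: hook2_step_def)
  show "finite B" using assms B by simp
  show "card B = card A" using a assms(2) card_Suc_Diff1[of A a] by (simp add: B)
  have "(-1::int) ^ (a - 2) = (-1) ^ a" using a by (auto simp: minus_one_power_iff)
  then show "alt_sum B = alt_sum A" using a assms(2) by (simp add: B alt_sum_def sum.remove[of A a "\<lambda>x. (-1) ^ x"])
  show "\<Sum>B < \<Sum>A" using a assms(2) by (simp add: B sum.remove[of A a "\<lambda>x. x"])
qed

lemma hook2_steps_props: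
  assumes "hook2_step\<^sup>*\<^sup>* A B" "finite A"
  shows "finite B \<and> card B = card A \<and> alt_sum B = alt_sum A"
  using assms by (induction rule: rtranclp_induct) (use hook2_step_props in auto)

lemma is_two_core_of_imp:
  assumes A: "finite A" and C: "is_two_core_of A C"
  shows "C = core A"
proof -
  have fC: "finite C" "card C = card A" "alt_sum C = alt_sum A"
    using C hook2_steps_props A unfolding is_two_core_of_def by blast+
  have no: "\<not> hook2_step C B" for B using C by (auto simp: is_two_core_of_def)
  have sl: "slice 2 C j = {..<card (slice 2 C j)}" for j
  proof (rule downward_closed_eq_lessThan)
    show "finite (slice 2 C j)" by (rule finite_slice[OF fC(1)]) simp
    fix q assume "Suc q \<in> slice 2 C j"
    then have a: "2 * Suc q + j \<in> C" by (simp add: slice_def)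
    have "2 * Suc q + j - 2 \<in> C"
    proof (rule ccontr)
      assume "2 * Suc q + j - 2 \<notin> C"
      then have "hook2_step C (insert (2 * Suc q + j - 2) (C - {2 * Suc q + j}))"
        unfolding hook2_step_def by (intro bexI[OF _ a]) simp
      then show False using no by blast
    qed
    then show "q \<in> slice 2 C j" by (simp add: slice_def)
  qed
  have "core A = core C" using A fC by (intro core_cong) auto
  also have "\<dots> = C" 
  proof (rule slices_eqI)
    show "slice 2 (core C) 0 = slice 2 C 0" by (rule trans[OF slice_core sl[symmetric]]) simp
    show "slice 2 (core C) 1 = slice 2 C 1" by (rule trans[OF slice_core sl[symmetric]]) simp
  qed
  finally show ?thesis ..
qed

lemma is_two_core_of_core:
  assumes "finite A"
  shows "is_two_core_of A (core A)"
proof -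
  have "\<exists>C. is_two_core_of A C" using assms
  proof (induction "\<Sum>A" arbitrary: A rule: less_induct)
    case less
    show ?case
    proof (cases "\<exists>B. hook2_step A B")
      case True
      then obtain B where B: "hook2_step A B" by blast
      then obtain C where "is_two_core_of B C" using less hook2_step_props[OF B less.prems] by blast
      then show ?thesis using B unfolding is_two_core_of_def by (meson converse_rtranclp_into_rtranclp)
    next
      case False
      then show ?thesis unfolding is_two_core_of_def by blast
    qed
  qed
  then show ?thesis using is_two_core_of_imp[OF assms] by metis
qed

lemma two_core_size_eq: "two_core_size lam = beta_size (core (set (degseq lam)))"
  unfolding two_core_size_def
proof (rule the_equality)
  let ?A = "set (degseq lam)"
  show "\<exists>C. is_two_core_of ?A C \<and> beta_size (core ?A) = \<Sum>C - (card C choose 2)"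
    using is_two_core_of_core[of ?A] by (auto simp: beta_size_def)
  show "s = beta_size (core ?A)" if "\<exists>C. is_two_core_of ?A C \<and> s = \<Sum>C - (card C choose 2)" for s
    using that is_two_core_of_imp[of ?A] by (auto simp: beta_size_def)
qed

section \<open>The right-most edge of the Newton polygon\<close>

lemma coeff_div_X_power:
  fixes f :: "int poly"
  assumes "\<And>i. i < s \<Longrightarrow> coeff f i = 0"
  shows "coeff (f div [:0, 1:] ^ s) t = coeff f (s + t)"
proof -
  have "f = [:0, 1:] ^ s * poly_shift s f"
    by (rule poly_eqI) (use assms in \<open>simp add: monom_altdef[of 1, simplified, symmetric] coeff_monom_mult coeff_poly_shift\<close>)
  then have "f div [:0, 1:] ^ s = [:0, 1:] ^ s * poly_shift s f div [:0, 1:] ^ s" by simp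
  also have "\<dots> = poly_shift s f" by (rule nonzero_mult_div_cancel_left) simp
  finally have "f div [:0, 1:] ^ s = poly_shift s f" .
  then show ?thesis by (simp add: coeff_poly_shift add.commute)
qed

text \<open>Counting k = N - j from the right end, the lower convex hull ends with the steepest
  chord, so the \<open>THE\<close> is the maximum of \<open>f k\<close> over nonzero coefficients.
  An upper bound needs the maximizing k only; a lower bound needs any one k.\<close>

lemma right_edge_slope:
  fixes p :: nat
  assumes "coeff G 0 \<noteq> 0" "degree G > 0"
  defines "f \<equiv> \<lambda>k. (real (vp p (coeff G 0)) - real (vp p (coeff G k))) / real k"
  shows "\<exists>k\<ge>1. coeff G k \<noteq> 0 \<and> right_edge_slope p G = f k"
    and "k \<ge> 1 \<Longrightarrow> coeff G k \<noteq> 0 \<Longrightarrow> f k \<le> right_edge_slope p G"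
proof -
  define N where "N = degree G"
  define K where "K = {k. 1 \<le> k \<and> k \<le> N \<and> coeff G k \<noteq> 0}"
  have "finite K" by (rule finite_subset[of _ "{..N}"]) (auto simp: K_def)
  moreover have "N \<in> K" using assms by (auto simp: K_def N_def)
  ultimately have M: "Max (f ` K) \<in> f ` K" "\<And>k. k \<in> K \<Longrightarrow> f k \<le> Max (f ` K)"
  proof -
    assume "finite K" "N \<in> K"
    then show "Max (f ` K) \<in> f ` K" "\<And>k. k \<in> K \<Longrightarrow> f k \<le> Max (f ` K)" by (blast intro: Max_in, simp)
  qed
  have iff: "(\<exists>j<N. coeff G (N - j) \<noteq> 0 \<and>
      \<sigma> = (real (vp p (coeff G 0)) - real (vp p (coeff G (N - j)))) / (real N - real j) \<and>
      (\<forall>i\<le>N. coeff G (N - i) \<noteq> 0 \<longrightarrow>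
         real (vp p (coeff G (N - i))) \<ge> real (vp p (coeff G 0)) + \<sigma> * (real i - real N)))
     \<longleftrightarrow> \<sigma> \<in> f ` K \<and> (\<forall>k\<in>K. f k \<le> \<sigma>)" for \<sigma>
  proof -
    have le: "f k \<le> \<sigma> \<longleftrightarrow> real (vp p (coeff G k)) \<ge> real (vp p (coeff G 0)) - \<sigma> * real k" if "k \<ge> 1" for k
      using that unfolding f_def by (simp add: divide_le_eq algebra_simps)
    have A: "(\<exists>j<N. coeff G (N - j) \<noteq> 0 \<and> \<sigma> = (real (vp p (coeff G 0)) - real (vp p (coeff G (N - j)))) / (real N - real j) \<and> P)
       \<longleftrightarrow> \<sigma> \<in> f ` K \<and> P" for P
    proof
      assume "\<exists>j<N. coeff G (N - j) \<noteq> 0 \<and> \<sigma> = (real (vp p (coeff G 0)) - real (vp p (coeff G (N - j)))) / (real N - real j) \<and> P"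
      then obtain j where "j < N" "coeff G (N - j) \<noteq> 0" "\<sigma> = (real (vp p (coeff G 0)) - real (vp p (coeff G (N - j)))) / (real N - real j)" P by blast
      then show "\<sigma> \<in> f ` K \<and> P" by (auto simp: K_def f_def of_nat_diff intro!: image_eqI[of _ _ "N - j"])
    next
      assume "\<sigma> \<in> f ` K \<and> P"
      then obtain k where "k \<in> K" "\<sigma> = f k" P by blast
      then show "\<exists>j<N. coeff G (N - j) \<noteq> 0 \<and> \<sigma> = (real (vp p (coeff G 0)) - real (vp p (coeff G (N - j)))) / (real N - real j) \<and> P"
        by (intro exI[of _ "N - k"]) (auto simp: K_def f_def of_nat_diff)
    qed
    have B: "(\<forall>i\<le>N. coeff G (N - i) \<noteq> 0 \<longrightarrow> real (vp p (coeff G (N - i))) \<ge> real (vp p (coeff G 0)) + \<sigma> * (real i - real N))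
      \<longleftrightarrow> (\<forall>k\<in>K. f k \<le> \<sigma>)"
    proof
      assume L: "\<forall>i\<le>N. coeff G (N - i) \<noteq> 0 \<longrightarrow> real (vp p (coeff G (N - i))) \<ge> real (vp p (coeff G 0)) + \<sigma> * (real i - real N)"
      show "\<forall>k\<in>K. f k \<le> \<sigma>"
      proof
        fix k assume "k \<in> K"
        then show "f k \<le> \<sigma>" using L[rule_format, of "N - k"] le[of k] by (simp add: K_def of_nat_diff)
      qed
    next
      assume R: "\<forall>k\<in>K. f k \<le> \<sigma>"
      show "\<forall>i\<le>N. coeff G (N - i) \<noteq> 0 \<longrightarrow> real (vp p (coeff G (N - i))) \<ge> real (vp p (coeff G 0)) + \<sigma> * (real i - real N)"
      proof (intro allI impI)
        fix i assume i: "i \<le> N" "coeff G (N - i) \<noteq> 0"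
        show "real (vp p (coeff G (N - i))) \<ge> real (vp p (coeff G 0)) + \<sigma> * (real i - real N)"
        proof (cases "i = N")
          case False
          then have "N - i \<in> K" using i by (auto simp: K_def)
          then show ?thesis using R le[of "N - i"] False i by (simp add: of_nat_diff algebra_simps)
        qed simp
      qed
    qed
    show ?thesis unfolding B A ..
  qed
  have "right_edge_slope p G = Max (f ` K)"
    unfolding right_edge_slope_def N_def[symmetric] iff
  proof (rule the_equality)
    show "Max (f ` K) \<in> f ` K \<and> (\<forall>k\<in>K. f k \<le> Max (f ` K))" using M by blast
    show "\<sigma> = Max (f ` K)" if "\<sigma> \<in> f ` K \<and> (\<forall>k\<in>K. f k \<le> \<sigma>)" for \<sigma>
    proof (rule antisym)
      show "\<sigma> \<le> Max (f ` K)" using that M(2) by blast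
      obtain k where "k \<in> K" "Max (f ` K) = f k" using M(1) by blast
      then show "Max (f ` K) \<le> \<sigma>" using that by simp
    qed
  qed
  then show "\<exists>k\<ge>1. coeff G k \<noteq> 0 \<and> right_edge_slope p G = f k"
    "k \<ge> 1 \<Longrightarrow> coeff G k \<noteq> 0 \<Longrightarrow> f k \<le> right_edge_slope p G"
    using M le_degree[of G k] by (auto simp: K_def N_def)
qed

section \<open>Determinant identities for the lowest coefficient\<close>

lemma vp_vandermonde:
  assumes p: "prime p"
  shows "inj_on x {..<r} \<Longrightarrow> 2 * vp p (vandermonde r x) = (\<Sum>i<r. \<Sum>j<r. vp p (x i - x j))"
proof (induction r)
  case 0
  then show ?case by (simp add: vandermonde_def vp_def)
next
  case (Suc r)
  have inj: "inj_on x {..<r}" using Suc.prems by (auto simp: inj_on_def)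
  have ne: "x r - x i \<noteq> 0" if "i < r" for i using inj_onD[OF Suc.prems, of r i] that by auto
  have sym: "vp p (x i - x r) = vp p (x r - x i)" for i using vp_minus[of p "x i - x r"] by simp
  have "vp p (vandermonde (Suc r) x) = vp p (vandermonde r x) + (\<Sum>i<r. vp p (x r - x i))"
  proof -
    have "vp p (\<Prod>i<r. x r - x i) = (\<Sum>i<r. vp p (x r - x i))" using ne by (intro vp_prod[OF p]) auto
    moreover have "(\<Prod>i<r. x r - x i) \<noteq> 0" using ne by auto
    ultimately show ?thesis unfolding vandermonde_Suc using inj vandermonde_nonzero_iff[of r x] by (simp add: vp_mult[OF p])
  qed
  then show ?case using Suc.IH[OF inj] by (simp add: sum.distrib sym)
qed

lemma det_scale_rows_columns:
  fixes M :: "nat \<Rightarrow> nat \<Rightarrow> int"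
  shows "det (mat r r (\<lambda>(i,j). x i * y j * M i j)) = (\<Prod>i<r. x i) * (\<Prod>j<r. y j) * det (mat r r (\<lambda>(i,j). M i j))"
proof -
  have "(\<Prod>j<r. x (q j) * y j * M (q j) j) = (\<Prod>i<r. x i) * (\<Prod>j<r. y j) * (\<Prod>j<r. M (q j) j)"
    if "q permutes {..<r}" for q
    using prod.permute[OF that, of x] by (simp add: prod.distrib o_def)
  then show ?thesis unfolding det_mat_columns sum_distrib_left by (intro sum.cong) (auto simp: mult_ac)
qed

lemma vandermonde_permute:
  assumes q: "q permutes {..<r}"
  shows "vandermonde r (\<lambda>j. x (q j)) = signof q * vandermonde r x"
proof -
  define M where "M = mat r r (\<lambda>(j,i). poly (ffpoly i) (x j))"
  have M: "M \<in> carrier_mat r r" by (simp add: M_def)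
  have q': "q permutes {0..<r}" using q by (simp add: lessThan_atLeast0)
  have *: "vandermonde r y = det (mat r r (\<lambda>(j,i). poly (ffpoly i) (y j)))" for y
  proof -
    have "mat r r (\<lambda>(j,i). poly (ffpoly i) (y j)) = transpose_mat (mat r r (\<lambda>(i,j). poly (ffpoly i) (y j)))"
      by (rule eq_matI) auto
    then show ?thesis using det_ffpoly[of r y] det_transpose[of "mat r r (\<lambda>(i,j). poly (ffpoly i) (y j))" r] by simp
  qed
  have "mat r r (\<lambda>(i,j). M $$ (q i, j)) = mat r r (\<lambda>(j,i). poly (ffpoly i) (x (q j)))"
    using permutes_in_image[OF q] by (intro eq_matI) (auto simp: M_def)
  then show ?thesis using det_permute_rows[OF M q'] *[of x] *[of "\<lambda>j. x (q j)"] by (simp add: M_def)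
qed

text \<open>Integrality of t is the point: the t become entries of an integer matrix. The recursion
  comes from X - x = (X - l) + (l - x).\<close>

lemma prod_ffpoly_expansion:
  assumes "finite (S :: nat set)"
  shows "\<exists>t::nat \<Rightarrow> int. \<forall>X. (\<Prod>s\<in>S. X - int s) = (\<Sum>l\<le>card S. t l * poly (ffpoly l) X)"
  using assms
proof (induction S)
  case empty
  then show ?case by (intro exI[of _ "\<lambda>_. 1"]) simp
next
  case (insert x S)
  then obtain t where t: "\<And>X. (\<Prod>s\<in>S. X - int s) = (\<Sum>l\<le>card S. t l * poly (ffpoly l) X)" by blast
  define c where "c = card S"
  define t' where "t' l = (if l = 0 then 0 else t (l - 1)) + (if l \<le> c then t l * (int l - int x) else 0)" for l
  have "(\<Prod>s\<in>insert x S. X - int s) = (\<Sum>l\<le>Suc c. t' l * poly (ffpoly l) X)" for X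
  proof -
    have "(\<Prod>s\<in>insert x S. X - int s) = (\<Sum>l\<le>c. t l * ((X - int x) * poly (ffpoly l) X))"
      using insert by (simp add: t c_def sum_distrib_left mult_ac)
    also have "\<dots> = (\<Sum>l\<le>c. t l * poly (ffpoly (Suc l)) X + t l * (int l - int x) * poly (ffpoly l) X)"
      by (intro sum.cong refl) (simp add: ffpoly_Suc algebra_simps)
    also have "\<dots> = (\<Sum>l\<le>c. t l * poly (ffpoly (Suc l)) X) + (\<Sum>l\<le>c. t l * (int l - int x) * poly (ffpoly l) X)"
      by (rule sum.distrib)
    also have "(\<Sum>l\<le>c. t l * poly (ffpoly (Suc l)) X) = (\<Sum>l\<le>Suc c. (if l = 0 then 0 else t (l - 1)) * poly (ffpoly l) X)"
      by (subst sum.atMost_Suc_shift) simp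
    also have "(\<Sum>l\<le>c. t l * (int l - int x) * poly (ffpoly l) X) = (\<Sum>l\<le>Suc c. (if l \<le> c then t l * (int l - int x) else 0) * poly (ffpoly l) X)"
      by simp
    finally show ?thesis by (simp add: t'_def distrib_right flip: sum.distrib)
  qed
  then show ?case using insert by (intro exI[of _ t']) (simp add: c_def)
qed

subsection \<open>Valuations of the coefficients\<close>

lemma odd_prime_gt_2: "prime (p::nat) \<Longrightarrow> odd p \<Longrightarrow> \<not> int p dvd 2"
proof
  assume p: "prime p" "odd p" "int p dvd 2"
  have "int p dvd int 2" using p(3) by simp
  then have "p dvd 2" by (simp only: int_dvd_int_iff)
  then have "p \<le> 2" by (rule dvd_imp_le) simp
  then have "p = 2" using prime_ge_2_nat[OF p(1)] by simp
  then show False using p(2) by simp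
qed

lemma vp_power_2: "prime p \<Longrightarrow> odd p \<Longrightarrow> vp p (2 ^ k) = 0"
proof (rule vp_not_dvd)
  assume p: "prime p" "odd p"
  show "\<not> int p dvd 2 ^ k"
  proof
    assume "int p dvd 2 ^ k"
    then have "int p dvd 2" by (rule prime_dvd_power[rotated]) (use p in simp)
    then show False using odd_prime_gt_2[OF p] by blast
  qed
qed

lemma vp_minus_one_power_mult: "vp p ((-1) ^ k * x) = vp p x"
  by (cases "even k") simp_all

text \<open>With n = m + 2k the valuation is v(n!) - v(k!) - v(m!), as 2 is a unit at p. Weakening k
  to n div 2 makes the part depending on n independent of m; summed over the entries it is
  \<open>odd_part_val\<close>.\<close>

lemma vp_coeff_herm_ge:
  assumes p: "prime p" "odd p" and nz: "coeff (herm n) m \<noteq> 0"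
  shows "vp p (fact n) \<le> vp p (coeff (herm n) m) + vp p (fact m) + vp p (fact (n div 2))"
proof -
  have mn: "m \<le> n" using nz coeff_herm_above[of n m] by (rule_tac ccontr) simp
  have ev: "even (n + m)" using nz coeff_herm_odd[of n m] by blast
  define k where "k = (n - m) div 2"
  have n: "n = m + 2 * k" using mn ev unfolding k_def by presburger
  have "vp p (coeff (herm n) m * (fact k * 2 ^ k * fact m)) = vp p (fact n)"
    unfolding n coeff_herm vp_minus_one_power_mult ..
  then have "vp p (coeff (herm n) m) + (vp p (fact k) + vp p (fact m)) = vp p (fact n)"
    using vp_mult[OF p(1) nz, of "fact k * 2 ^ k * fact m"] by (simp add: vp_mult[OF p(1)] vp_power_2[OF p])
  moreover have "vp p (fact k) \<le> vp p (fact (n div 2))" by (rule vp_fact_mono[OF p(1)]) (simp add: n)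
  ultimately show ?thesis by simp
qed

text \<open>The valuation of the product of the double factorials of the odd numbers up to \<open>n\<^sub>j\<close>.\<close>

definition odd_part_val :: "nat \<Rightarrow> nat list \<Rightarrow> int" where
  "odd_part_val p ns = (\<Sum>j<length ns. int (vp p (fact (ns ! j))) - int (vp p (fact (ns ! j div 2))))"

text \<open>A nonzero Vandermonde factor makes the exponents distinct, and nonzero Hermite
  coefficients give them the parities of the entries. So the exponents form a degree set of size t
  with the same 2-core.\<close>

lemma nonzero_term_props:
  fixes ns :: "nat list" and \<mu> :: "nat \<Rightarrow> nat"
  defines "r \<equiv> length ns"
  assumes ns: "distinct ns" and s: "(\<Sum>j<r. \<mu> j) = t + (r choose 2)"
    and nz: "(\<Prod>j<r. coeff (herm (ns ! j)) (\<mu> j)) * vandermonde r (\<lambda>j. int (\<mu> j)) \<noteq> 0"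
  shows "inj_on \<mu> {..<r}" "card (\<mu> ` {..<r}) = card (set ns)" "alt_sum (\<mu> ` {..<r}) = alt_sum (set ns)"
    "beta_size (\<mu> ` {..<r}) = t"
proof -
  have "inj_on (\<lambda>j. int (\<mu> j)) {..<r}" using nz vandermonde_nonzero_iff[of r "\<lambda>j. int (\<mu> j)"] by auto
  then show inj: "inj_on \<mu> {..<r}" by (auto simp: inj_on_def)
  show c: "card (\<mu> ` {..<r}) = card (set ns)" using card_image[OF inj] distinct_card[OF ns] by (simp add: r_def)
  have bij: "bij_betw ((!) ns) {..<r} (set ns)" by (rule bij_betw_nth) (use ns in \<open>auto simp: r_def\<close>)
  have "alt_sum (\<mu> ` {..<r}) = (\<Sum>j<r. (-1) ^ \<mu> j)" unfolding alt_sum_def by (simp add: sum.reindex[OF inj])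
  also have "\<dots> = (\<Sum>j<r. (-1) ^ (ns ! j))"
  proof (intro sum.cong refl)
    fix j assume "j \<in> {..<r}"
    then have "coeff (herm (ns ! j)) (\<mu> j) \<noteq> 0" using nz by auto
    then have "even (ns ! j + \<mu> j)" using coeff_herm_odd[of "ns ! j" "\<mu> j"] by blast
    then show "(-1::int) ^ \<mu> j = (-1) ^ (ns ! j)" by (simp add: minus_one_power_iff)
  qed
  also have "\<dots> = alt_sum (set ns)" unfolding alt_sum_def by (rule sum.reindex_bij_betw[OF bij])
  finally show "alt_sum (\<mu> ` {..<r}) = alt_sum (set ns)" .
  have "\<Sum>(\<mu> ` {..<r}) = t + (r choose 2)" using s by (simp add: sum.reindex[OF inj])
  then show "beta_size (\<mu> ` {..<r}) = t" using card_image[OF inj] by (simp add: beta_size_def)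
qed

lemma vp_vandermonde_image:
  assumes "prime p" "inj_on \<mu> {..<r}"
  shows "2 * int (vp p (vandermonde r (\<lambda>j. int (\<mu> j)))) = (\<Sum>a\<in>\<mu> ` {..<r}. \<Sum>b\<in>\<mu> ` {..<r}. int (vp p (int a - int b)))"
proof -
  have "inj_on (\<lambda>j. int (\<mu> j)) {..<r}" using assms(2) by (auto simp: inj_on_def)
  from vp_vandermonde[OF assms(1) this] have "2 * int (vp p (vandermonde r (\<lambda>j. int (\<mu> j)))) = int (\<Sum>i<r. \<Sum>j<r. vp p (int (\<mu> i) - int (\<mu> j)))"
    by linarith
  then have "2 * int (vp p (vandermonde r (\<lambda>j. int (\<mu> j)))) = (\<Sum>i<r. \<Sum>j<r. int (vp p (int (\<mu> i) - int (\<mu> j))))"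
    by (simp only: of_nat_sum)
  then show ?thesis by (simp add: sum.reindex[OF assms(2)])
qed

lemma coeff_wronskian_vp_ge:
  assumes p: "prime p" "odd p" and ns: "distinct ns"
    and nz: "coeff (wronskian (map herm ns)) t \<noteq> 0"
    and H: "\<And>A. finite A \<Longrightarrow> card A = card (set ns) \<Longrightarrow> alt_sum A = alt_sum (set ns) \<Longrightarrow> beta_size A = t \<Longrightarrow> hook_val p A \<le> H"
  shows "2 * int (vp p (coeff (wronskian (map herm ns)) t)) \<ge> 2 * odd_part_val p ns - H"
proof -
  define r where "r = length ns"
  define B where "B = sum_list ns"
  \<comment> \<open>Half of the bound rounded up, since the statement is doubled; \<open>nat\<close>
    turns a negative bound into the trivial power.\<close>
  define e where "e = nat ((2 * odd_part_val p ns - H + 1) div 2)"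
  have B: "ns ! j \<le> B" if "j < length ns" for j using that elem_le_sum_list[of j ns] by (simp add: B_def)
  have W: "coeff (wronskian (map herm ns)) t = 
    (\<Sum>\<mu> | \<mu> \<in> PiE {..<r} (\<lambda>_. {..B}) \<and> (\<Sum>j<r. \<mu> j) = t + (r choose 2). 
       (\<Prod>j<r. coeff (herm (ns ! j)) (\<mu> j)) * vandermonde r (\<lambda>j. int (\<mu> j)))" for t
    unfolding r_def by (rule coeff_wronskian_herm) (rule B)
  have "int p ^ e dvd coeff (wronskian (map herm ns)) t"
    unfolding W
  proof (rule dvd_sum)
    fix \<mu> assume "\<mu> \<in> {\<mu>. \<mu> \<in> PiE {..<r} (\<lambda>_. {..B}) \<and> (\<Sum>j<r. \<mu> j) = t + (r choose 2)}"
    then have s: "(\<Sum>j<r. \<mu> j) = t + (r choose 2)" by blast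
    let ?t1 = "\<Prod>j<r. coeff (herm (ns ! j)) (\<mu> j)" and ?t2 = "vandermonde r (\<lambda>j. int (\<mu> j))"
    show "int p ^ e dvd ?t1 * ?t2"
    proof (cases "?t1 * ?t2 = 0")
      case True
      show ?thesis unfolding True by simp
    next
      case False
      note props = nonzero_term_props[OF ns s[unfolded r_def] False[unfolded r_def], folded r_def]
      let ?A = "\<mu> ` {..<r}"
      have hA: "hook_val p ?A \<le> H" using H props by blast
      have nz1: "coeff (herm (ns ! j)) (\<mu> j) \<noteq> 0" if "j < r" for j using False that by auto
      have "vp p ?t1 = (\<Sum>j<r. vp p (coeff (herm (ns ! j)) (\<mu> j)))" by (rule vp_prod[OF p(1)]) (use nz1 in auto)
      then have "int (vp p ?t1) = (\<Sum>j<r. int (vp p (coeff (herm (ns ! j)) (\<mu> j))))" by simp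
      also have "\<dots> \<ge> (\<Sum>j<r. int (vp p (fact (ns ! j))) - int (vp p (fact (ns ! j div 2))) - int (vp p (fact (\<mu> j))))"
      proof (rule sum_mono)
        fix j assume "j \<in> {..<r}"
        then show "int (vp p (fact (ns ! j))) - int (vp p (fact (ns ! j div 2))) - int (vp p (fact (\<mu> j))) \<le> int (vp p (coeff (herm (ns ! j)) (\<mu> j)))"
          using vp_coeff_herm_ge[OF p nz1[of j]] by simp
      qed
      also have "(\<Sum>j<r. int (vp p (fact (ns ! j))) - int (vp p (fact (ns ! j div 2))) - int (vp p (fact (\<mu> j)))) = 
          odd_part_val p ns - (\<Sum>a\<in>?A. int (vp p (fact a)))"
        by (simp add: odd_part_val_def r_def[symmetric] sum_subtractf sum.reindex[OF props(1)])
      finally have "2 * int (vp p ?t1) + 2 * int (vp p ?t2) \<ge> 2 * odd_part_val p ns - hook_val p ?A"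
        unfolding vp_vandermonde_image[OF p(1) props(1)] hook_val_def by simp
      moreover have "vp p (?t1 * ?t2) = vp p ?t1 + vp p ?t2" using False by (intro vp_mult[OF p(1)]) auto
      ultimately have "e \<le> vp p (?t1 * ?t2)" using hA unfolding e_def by linarith
      then show ?thesis using vp_ge_iff[OF p(1) False] by blast
    qed
  qed
  then have "e \<le> vp p (coeff (wronskian (map herm ns)) t)" using vp_ge_iff[OF p(1) nz] by blast
  then show ?thesis unfolding e_def by linarith
qed

lemma Delta_not_dvd_imp:
  assumes "\<not> int p dvd Delta ns" "a \<in> set ns" "b \<in> set ns" "a \<noteq> b"
  shows "\<not> int p dvd int a - int b"
proof -
  have *: "\<not> int p dvd int (ns ! j) - int (ns ! i)" if "i < j" "j < length ns" for i j
  proof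
    assume d: "int p dvd int (ns ! j) - int (ns ! i)"
    have "int (ns ! j) - int (ns ! i) dvd (\<Prod>i<j. int (ns ! j) - int (ns ! i))"
      by (rule dvd_prodI) (use that in auto)
    also have "\<dots> dvd vandermonde (length ns) (\<lambda>i. int (ns ! i))"
      unfolding vandermonde_def by (rule dvd_prodI[of _ _ "\<lambda>j. \<Prod>i<j. int (ns ! j) - int (ns ! i)"]) (use that in auto)
    finally show False using d assms(1) dvd_trans unfolding Delta_vandermonde by blast
  qed
  obtain i j where ij: "i < length ns" "a = ns ! i" "j < length ns" "b = ns ! j" using assms by (auto simp: in_set_conv_nth)
  show ?thesis
  proof (cases i j rule: linorder_cases)
    case less
    then show ?thesis using *[of i j] ij dvd_diff_commute[of "int p" "int a" "int b"] by blast
  next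
    case equal
    then show ?thesis using ij assms(4) by blast
  next
    case greater
    then show ?thesis using *[of j i] ij by blast
  qed
qed

text \<open>Lagrange polynomials through the points of equal parity, expanded in the falling factorial basis, give an
integer matrix that makes this one diagonal with diagonal entries prime to \<open>p\<close>.\<close>

lemma det_parity_matrix:
  fixes ns :: "nat list" and q :: "nat \<Rightarrow> nat"
  defines "r \<equiv> length ns"
  assumes p: "prime p" "odd p" and ns: "distinct ns" "\<not> int p dvd Delta ns"
    and q: "bij_betw q {..<r} (core (set ns))"
  shows "\<not> int p dvd det (mat r r (\<lambda>(i,j). if q i mod 2 = ns ! j mod 2 then poly (ffpoly (q i div 2)) (int (ns ! j div 2)) else 0))"
proof
  define A where "A = set ns"
  define n where "n j = ns ! j" for j
  define M where "M = mat r r (\<lambda>(i,j). if q i mod 2 = n j mod 2 then poly (ffpoly (q i div 2)) (int (n j div 2)) else 0)"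
  assume "int p dvd det (mat r r (\<lambda>(i,j). if q i mod 2 = ns ! j mod 2 then poly (ffpoly (q i div 2)) (int (ns ! j div 2)) else 0))"
  then have dvdM: "int p dvd det M" unfolding M_def n_def .
  \<comment> \<open>The interpolation nodes for \<open>n b\<close>: the halves of the other entries
    of the same parity. The product over them is the Lagrange numerator.\<close>
  define S where "S b = slice 2 A (n b mod 2) - {n b div 2}" for b
  have fA: "finite A" by (simp add: A_def)
  have fs: "finite (slice 2 A j)" for j by (rule finite_slice[OF fA]) simp
  have nA: "n b \<in> A" if "b < r" for b using that by (simp add: A_def n_def r_def)
  have n_sl: "n b div 2 \<in> slice 2 A (n b mod 2)" if "b < r" for b using nA[OF that] by (simp add: slice_def)
  have "\<exists>t. \<forall>X. (\<Prod>s\<in>S b. X - int s) = (\<Sum>l\<le>card (S b). t l * poly (ffpoly l) X)" for b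
    by (rule prod_ffpoly_expansion) (simp add: S_def fs)
  then have "\<forall>b. \<exists>t. \<forall>X. (\<Prod>s\<in>S b. X - int s) = (\<Sum>l\<le>card (S b). t l * poly (ffpoly l) X)" by blast
  from choice[OF this] obtain t where t: "\<And>b X. (\<Prod>s\<in>S b. X - int s) = (\<Sum>l\<le>card (S b). t b l * poly (ffpoly l) X)" by blast
  \<comment> \<open>One node is left out, so degrees 0 to \<open>card (S b)\<close> run exactly
    through the positions of the core in this parity class.\<close>
  have cS: "{..card (S b)} = {..<card (slice 2 A (n b mod 2))}" if "b < r" for b
    using card_Suc_Diff1[OF fs n_sl[OF that]] by (simp add: S_def lessThan_Suc_atMost[symmetric])
  define T where "T = mat r r (\<lambda>(b,i). if q i mod 2 = n b mod 2 then t b (q i div 2) else 0)"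
  have TM: "(T * M) $$ (b, j) = (if b = j then \<Prod>s\<in>S b. int (n b div 2) - int s else 0)" if b: "b < r" and j: "j < r" for b j
  proof -
    define f where "f x = (if x mod 2 = n b mod 2 then t b (x div 2) else 0) * (if x mod 2 = n j mod 2 then poly (ffpoly (x div 2)) (int (n j div 2)) else 0)" for x
    have "(T * M) $$ (b, j) = (\<Sum>i<r. f (q i))"
      using b j by (simp add: T_def M_def scalar_prod_def f_def lessThan_atLeast0)
    also have "\<dots> = (\<Sum>x\<in>core A. f x)" unfolding A_def by (rule sum.reindex_bij_betw[OF q])
    also have "\<dots> = (\<Sum>jj<2. \<Sum>l\<in>slice 2 (core A) jj. f (2 * l + jj))" by (rule sum_slice[OF finite_core]) simp
    also have "\<dots> = (\<Sum>jj<2. if jj = n b mod 2 then (\<Sum>l<card (slice 2 A (n b mod 2)). f (2 * l + n b mod 2)) else 0)"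
      by (intro sum.cong refl) (auto simp: slice_core f_def)
    also have "\<dots> = (\<Sum>l<card (slice 2 A (n b mod 2)). f (2 * l + n b mod 2))" by (simp add: sum.delta)
    also have "\<dots> = (\<Sum>l\<le>card (S b). f (2 * l + n b mod 2))" unfolding cS[OF b] ..
    also have "\<dots> = (if n b mod 2 = n j mod 2 then \<Prod>s\<in>S b. int (n j div 2) - int s else 0)"
      by (simp add: f_def t)
    also have "\<dots> = (if b = j then \<Prod>s\<in>S b. int (n b div 2) - int s else 0)"
    proof (cases "b \<noteq> j \<and> n b mod 2 = n j mod 2")
      case True
      have "n b \<noteq> n j" using True ns(1) b j by (simp add: n_def r_def nth_eq_iff_index_eq)
      moreover have "n b = n j" if e: "n j div 2 = n b div 2"
      proof -
        have "n b = n b div 2 * 2 + n b mod 2" by (rule div_mult_mod_eq[symmetric])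
        also have "\<dots> = n j div 2 * 2 + n j mod 2" using True by (simp only: e)
        also have "\<dots> = n j" by (rule div_mult_mod_eq)
        finally show ?thesis .
      qed
      ultimately have "n j div 2 \<noteq> n b div 2" by blast
      then have "n j div 2 \<in> S b" using n_sl[OF j] True by (simp add: S_def)
      moreover have "finite (S b)" by (simp add: S_def fs)
      ultimately have "(\<Prod>s\<in>S b. int (n j div 2) - int s) = 0" by (auto simp: prod_zero_iff)
      then show ?thesis using True by simp
    qed auto
    finally show ?thesis .
  qed
  have TMc: "T * M \<in> carrier_mat r r" by (rule mult_carrier_mat[of _ _ r]) (simp_all add: T_def M_def)
  have "det (T * M) = prod_list (diag_mat (T * M))"
    by (rule det_upper_triangular[OF _ TMc]) (use TM TMc in \<open>auto simp: T_def M_def\<close>)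
  also have "\<dots> = (\<Prod>b<r. \<Prod>s\<in>S b. int (n b div 2) - int s)"
    using TMc TM by (auto simp: prod_list_diag_prod lessThan_atLeast0 intro!: prod.cong)
  finally have "det T * det M = (\<Prod>b<r. \<Prod>s\<in>S b. int (n b div 2) - int s)"
    using det_mult[of T r M] by (simp add: T_def M_def)
  then have "int p dvd (\<Prod>b<r. \<Prod>s\<in>S b. int (n b div 2) - int s)" using dvd_mult[OF dvdM, of "det T"] by simp
  moreover have pp: "prime (int p)" using p by simp
  ultimately obtain b where b: "b < r" "int p dvd (\<Prod>s\<in>S b. int (n b div 2) - int s)"
    by (auto simp: prime_dvd_prod_iff)
  moreover have "finite (S b)" by (simp add: S_def fs)
  ultimately obtain s where s: "s \<in> S b" "int p dvd int (n b div 2) - int s"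
    using pp by (auto simp: prime_dvd_prod_iff)
  have "2 * s + n b mod 2 \<in> A" using s by (auto simp: S_def slice_def)
  moreover have "n b \<noteq> 2 * s + n b mod 2" using s by (auto simp: S_def)
  ultimately have nd: "\<not> int p dvd int (n b) - int (2 * s + n b mod 2)"
    using nA[OF b(1)] unfolding A_def by (intro Delta_not_dvd_imp[OF ns(2)])
  \<comment> \<open>Equal parity: the difference of the entries is twice that of the halves, so a p
    dividing the latter would divide a factor of Delta.\<close>
  have "int (n b) - int (2 * s + n b mod 2) = 2 * (int (n b div 2) - int s)"
  proof -
    have "n b = 2 * (n b div 2) + n b mod 2" by simp
    then have "int (n b) = 2 * int (n b div 2) + int (n b mod 2)" by linarith
    then show ?thesis by (simp only: of_nat_add of_nat_mult of_nat_numeral) (simp only: right_diff_distrib add_diff_cancel_right)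
  qed
  then show False using nd dvd_mult[OF s(2), of 2] by (simp only: not_True_eq_False)
qed

section \<open>The lowest and the highest coefficient\<close>

lemma vandermonde_cong: "(\<And>j. j < r \<Longrightarrow> x j = y j) \<Longrightarrow> vandermonde r x = vandermonde r y"
  unfolding vandermonde_def by (intro prod.cong) auto

text \<open>Surviving exponent vectors are the rearrangements of one enumeration q of the core.
  Rearranging changes the Vandermonde factor by the sign only, and these signs assemble the Hermite
  coefficients into a determinant.\<close>

lemma coeff_wronskian_lowest:
  fixes ns :: "nat list"
  defines "A \<equiv> set ns"
  assumes ns: "distinct ns"
  obtains q where "bij_betw q {..<length ns} (core A)"
    "coeff (wronskian (map herm ns)) (beta_size (core A)) = 
       det (mat (length ns) (length ns) (\<lambda>(i,j). coeff (herm (ns ! j)) (q i))) * vandermonde (length ns) (\<lambda>i. int (q i))"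
proof -
  define r where "r = length ns"
  \<comment> \<open>The core sum is added so that every entry of the core lies below the
    bound.\<close>
  define B where "B = sum_list ns + \<Sum>(core A)"
  define s where "s = beta_size (core A)"
  have fA: "finite A" by (simp add: A_def)
  have cA: "card A = r" using distinct_card[OF ns] by (simp add: A_def r_def)
  obtain q where "bij_betw q {0..<card (core A)} (core A)" using ex_bij_betw_nat_finite[OF finite_core] by blast
  then have q: "bij_betw q {..<r} (core A)" by (simp add: core_card_alt_sum[OF fA] cA lessThan_atLeast0)
  have B: "ns ! j \<le> B" if "j < length ns" for j using that elem_le_sum_list[of j ns] by (simp add: B_def)
  let ?P = "{\<pi>. \<pi> permutes {..<r}}"
  let ?S = "{\<mu>. \<mu> \<in> PiE {..<r} (\<lambda>_. {..B}) \<and> (\<Sum>j<r. \<mu> j) = s + (r choose 2)}"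
  let ?g = "\<lambda>\<pi>. restrict (\<lambda>j. q (\<pi> j)) {..<r}"
  let ?T = "\<lambda>\<mu>. (\<Prod>j<r. coeff (herm (ns ! j)) (\<mu> j)) * vandermonde r (\<lambda>j. int (\<mu> j))"
  have inj: "inj_on ?g ?P"
  proof (rule inj_onI)
    fix \<pi> \<pi>' assume p: "\<pi> \<in> ?P" "\<pi>' \<in> ?P" and eq: "?g \<pi> = ?g \<pi>'"
    show "\<pi> = \<pi>'"
    proof
      fix j
      show "\<pi> j = \<pi>' j"
      proof (cases "j < r")
        case True
        then have "q (\<pi> j) = q (\<pi>' j)" using fun_cong[OF eq, of j] by simp
        moreover have "\<pi> j < r" "\<pi>' j < r" using True p permutes_in_image[of _ "{..<r}" j] by auto
        ultimately show ?thesis using inj_onD[OF bij_betw_imp_inj_on[OF q]] by auto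
      next
        case False
        then have "\<pi> j = j" "\<pi>' j = j" using p by (auto intro: permutes_not_in)
        then show ?thesis by simp
      qed
    qed
  qed
  have sub: "?g ` ?P \<subseteq> ?S"
  proof
    fix \<mu> assume "\<mu> \<in> ?g ` ?P"
    then obtain \<pi> where \<pi>: "\<pi> permutes {..<r}" "\<mu> = ?g \<pi>" by blast
    have "q i \<le> B" if "i < r" for i
    proof -
      have "q i \<in> core A" using q that by (auto simp: bij_betw_def)
      then have "q i \<le> \<Sum>(core A)" using member_le_sum[of "q i" "core A" "\<lambda>x. x"] finite_core by auto
      then show ?thesis by (simp add: B_def)
    qed
    moreover have "\<pi> j < r" if "j < r" for j using that \<pi> permutes_in_image[of _ "{..<r}" j] by auto
    moreover have "(\<Sum>j<r. \<mu> j) = (\<Sum>j<r. q (\<pi> j))" by (simp add: \<pi>)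
    moreover have "(\<Sum>j<r. q (\<pi> j)) = (\<Sum>j<r. q j)" using sum.permute[OF \<pi>(1), of q] by (simp add: o_def)
    moreover have "(\<Sum>j<r. q j) = \<Sum>(core A)" using sum.reindex_bij_betw[OF q, of "\<lambda>x. x"] .
    moreover have "\<Sum>(core A) = s + (r choose 2)" using sum_beta_size[OF finite_core[of A]] by (simp add: s_def core_card_alt_sum[OF fA] cA)
    ultimately show "\<mu> \<in> ?S" by (auto simp: \<pi>(2) PiE_iff)
  qed
  have zero: "?T \<mu> = 0" if "\<mu> \<in> ?S - ?g ` ?P" for \<mu>
  proof (rule ccontr)
    assume nz: "?T \<mu> \<noteq> 0"
    have s: "(\<Sum>j<r. \<mu> j) = s + (r choose 2)" and PiE: "\<mu> \<in> PiE {..<r} (\<lambda>_. {..B})" using that by blast+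
    note props = nonzero_term_props[OF ns s[unfolded r_def] nz[unfolded r_def], folded r_def A_def]
    let ?A = "\<mu> ` {..<r}"
    have c: "core ?A = core A" by (rule core_cong) (use props fA in auto)
    have "?A = core ?A" by (rule eq_core_if_beta_size) (use props c in \<open>auto simp: s_def\<close>)
    then have im: "?A = core A" using c by simp
    then have bij: "bij_betw \<mu> {..<r} (core A)" using props(1) by (simp add: bij_betw_def)
    define \<pi> where "\<pi> j = (if j < r then inv_into {..<r} q (\<mu> j) else j)" for j
    have "bij_betw (inv_into {..<r} q \<circ> \<mu>) {..<r} {..<r}" by (rule bij_betw_trans[OF bij bij_betw_inv_into[OF q]])
    then have "bij_betw \<pi> {..<r} {..<r}" by (rule bij_betw_cong[THEN iffD1, rotated]) (simp add: \<pi>_def)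
    then have "\<pi> permutes {..<r}" by (rule bij_imp_permutes) (simp add: \<pi>_def)
    moreover have "\<mu> = ?g \<pi>"
    proof
      fix j
      show "\<mu> j = ?g \<pi> j"
      proof (cases "j < r")
        case True
        then have "\<mu> j \<in> q ` {..<r}" using im q by (auto simp: bij_betw_def)
        then show ?thesis using True by (simp add: \<pi>_def f_inv_into_f)
      next
        case False
        then show ?thesis using PiE by (auto simp: PiE_def extensional_def)
      qed
    qed
    ultimately show False using that by blast
  qed
  have fS: "finite ?S" by (rule finite_subset[of _ "PiE {..<r} (\<lambda>_. {..B})"]) (auto intro!: finite_PiE)
  have "coeff (wronskian (map herm ns)) s = (\<Sum>\<mu>\<in>?S. ?T \<mu>)"
    unfolding r_def by (rule coeff_wronskian_herm) (rule B)
  also have "\<dots> = (\<Sum>\<mu>\<in>?g ` ?P. ?T \<mu>)" by (rule sum.mono_neutral_right[OF fS sub]) (use zero in blast)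
  also have "\<dots> = (\<Sum>\<pi>\<in>?P. ?T (?g \<pi>))" by (simp add: sum.reindex[OF inj])
  also have "\<dots> = (\<Sum>\<pi>\<in>?P. (signof \<pi> * (\<Prod>j<r. coeff (herm (ns ! j)) (q (\<pi> j)))) * vandermonde r (\<lambda>i. int (q i)))"
  proof (rule sum.cong[OF refl])
    fix \<pi> assume "\<pi> \<in> ?P"
    then have "vandermonde r (\<lambda>j. int (?g \<pi> j)) = signof \<pi> * vandermonde r (\<lambda>i. int (q i))"
      using vandermonde_permute[of \<pi> r "\<lambda>i. int (q i)"] vandermonde_cong[of r "\<lambda>j. int (?g \<pi> j)" "\<lambda>j. int (q (\<pi> j))"] by simp
    then show "?T (?g \<pi>) = (signof \<pi> * (\<Prod>j<r. coeff (herm (ns ! j)) (q (\<pi> j)))) * vandermonde r (\<lambda>i. int (q i))"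
      by simp
  qed
  also have "\<dots> = det (mat r r (\<lambda>(i,j). coeff (herm (ns ! j)) (q i))) * vandermonde r (\<lambda>i. int (q i))"
    unfolding det_mat_columns sum_distrib_right ..
  finally show ?thesis using that[OF q[unfolded r_def]] by (simp add: s_def r_def)
qed

text \<open>For n = m + 2k, 1/k! is the falling factorial of n div 2 of order m div 2, divided by (n
  div 2)!, and 2^k and (-1)^k split likewise. All other factors depend on m or on n alone, so the
  Hermite matrix is a row and column scaling of the one in \<open>det_parity_matrix\<close>.\<close>

lemma coeff_herm_scaled:
  "fact m * (fact (n div 2) * 2 ^ (n div 2)) * coeff (herm n) m = 
   ((-1) ^ (m div 2) * 2 ^ (m div 2)) * ((-1) ^ (n div 2) * fact n) * 
     (if m mod 2 = n mod 2 then poly (ffpoly (m div 2)) (int (n div 2)) else 0)"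
proof (cases "m mod 2 = n mod 2")
  case False
  then have "odd (n + m)" by (simp add: mod2_eq_if split: if_splits)
  then show ?thesis using False coeff_herm_odd by simp
next
  case True
  show ?thesis
  proof (cases "m \<le> n")
    case False
    then have "m div 2 > n div 2" using True div_mult_mod_eq[of n 2] div_mult_mod_eq[of m 2] by linarith
    then show ?thesis using False coeff_herm_above[of n m] poly_ffpoly_eq_0[of "n div 2" "m div 2"] by simp
  next
    case mn: True
    define k where "k = n div 2 - m div 2"
    have N: "n div 2 = k + m div 2" using mn by (simp add: k_def div_le_mono)
    have n: "n = m + 2 * k" using True N mn div_mult_mod_eq[of n 2] div_mult_mod_eq[of m 2] by linarith
    have f: "fact (n div 2) = poly (ffpoly (m div 2)) (int (n div 2)) * fact k"
      using poly_ffpoly_nat[of "m div 2" "n div 2"] N by simp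
    have c: "coeff (herm n) m * (fact k * 2 ^ k * fact m) = (-1) ^ k * fact n" using coeff_herm[of m k] by (simp only: n)
    have sg: "(-1::int) ^ k = (-1) ^ (m div 2) * (-1) ^ (n div 2)" unfolding N by (simp add: power_add flip: power_mult_distrib)
    have "fact m * (fact (n div 2) * 2 ^ (n div 2)) * coeff (herm n) m = 
      poly (ffpoly (m div 2)) (int (n div 2)) * 2 ^ (m div 2) * (coeff (herm n) m * (fact k * 2 ^ k * fact m))"
      unfolding f by (simp add: N power_add mult_ac)
    then show ?thesis unfolding c sg using True by (simp add: mult_ac)
  qed
qed

text \<open>Signs, powers of 2 and the determinant of the parity matrix are prime to p, so the
  valuation is read off from the factorials of the scaling; the Vandermonde factor completes them to
  the hook value of the core.\<close>

lemma vp_coeff_wronskian_lowest: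
  assumes p: "prime p" "odd p" and ns: "distinct ns" "\<not> int p dvd Delta ns"
  shows "coeff (wronskian (map herm ns)) (beta_size (core (set ns))) \<noteq> 0"
    "2 * int (vp p (coeff (wronskian (map herm ns)) (beta_size (core (set ns))))) = 2 * odd_part_val p ns - hook_val p (core (set ns))"
proof -
  define r where "r = length ns"
  obtain q where q: "bij_betw q {..<r} (core (set ns))" and
    W: "coeff (wronskian (map herm ns)) (beta_size (core (set ns))) = 
       det (mat r r (\<lambda>(i,j). coeff (herm (ns ! j)) (q i))) * vandermonde r (\<lambda>i. int (q i))"
    using coeff_wronskian_lowest[OF ns(1)] unfolding r_def by blast
  let ?C = "det (mat r r (\<lambda>(i,j). coeff (herm (ns ! j)) (q i)))"
  let ?M = "det (mat r r (\<lambda>(i,j). if q i mod 2 = ns ! j mod 2 then poly (ffpoly (q i div 2)) (int (ns ! j div 2)) else 0))"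
  have inj: "inj_on q {..<r}" and im: "q ` {..<r} = core (set ns)" using q by (auto simp: bij_betw_def)
  have M: "\<not> int p dvd ?M" using det_parity_matrix[OF p ns q[unfolded r_def]] by (simp add: r_def)
  then have M0: "?M \<noteq> 0" by auto
  let ?x = "\<lambda>i. fact (q i) :: int" and ?y = "\<lambda>j. fact (ns ! j div 2) * 2 ^ (ns ! j div 2) :: int"
  let ?x' = "\<lambda>i. (-1) ^ (q i div 2) * 2 ^ (q i div 2) :: int" and ?y' = "\<lambda>j. (-1) ^ (ns ! j div 2) * fact (ns ! j) :: int"
  have E: "(\<Prod>i<r. ?x i) * (\<Prod>j<r. ?y j) * ?C = (\<Prod>i<r. ?x' i) * (\<Prod>j<r. ?y' j) * ?M"
    unfolding det_scale_rows_columns[symmetric] coeff_herm_scaled ..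
  have nz: "(\<Prod>i<r. ?x i) \<noteq> 0" "(\<Prod>j<r. ?y j) \<noteq> 0" "(\<Prod>i<r. ?x' i) \<noteq> 0" "(\<Prod>j<r. ?y' j) \<noteq> 0" by auto
  have C0: "?C \<noteq> 0"
  proof
    assume "?C = 0"
    then have "(\<Prod>i<r. ?x' i) * (\<Prod>j<r. ?y' j) * ?M = 0" using E by (simp only: mult_zero_right)
    then show False using nz M0 by (simp only: mult_eq_0_iff) blast
  qed
  have vp3: "vp p (a * b * c) = vp p a + vp p b + vp p c" if "a \<noteq> 0" "b \<noteq> 0" "c \<noteq> 0" for a b c
    using that by (simp add: vp_mult[OF p(1)])
  have eq: "vp p (\<Prod>i<r. ?x i) + vp p (\<Prod>j<r. ?y j) + vp p ?C = vp p (\<Prod>i<r. ?x' i) + vp p (\<Prod>j<r. ?y' j) + vp p ?M"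
    using arg_cong[OF E, of "vp p"] unfolding vp3[OF nz(1,2) C0] vp3[OF nz(3,4) M0] .
  have "inj_on (\<lambda>i. int (q i)) {..<r}" using inj by (auto simp: inj_on_def)
  then have V0: "vandermonde r (\<lambda>i. int (q i)) \<noteq> 0" using vandermonde_nonzero_iff[of r "\<lambda>i. int (q i)"] by blast
  show "coeff (wronskian (map herm ns)) (beta_size (core (set ns))) \<noteq> 0" using W C0 V0 by simp
  have v: "vp p (\<Prod>i<r. ?x i) = (\<Sum>i<r. vp p (fact (q i)))" "vp p (\<Prod>j<r. ?y j) = (\<Sum>j<r. vp p (fact (ns ! j div 2)))"
     "vp p (\<Prod>i<r. ?x' i) = 0" "vp p (\<Prod>j<r. ?y' j) = (\<Sum>j<r. vp p (fact (ns ! j)))"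
    using p by (simp_all add: vp_prod vp_mult vp_power_2 vp_minus_one_power_mult)
  have "int (vp p ?C) = (\<Sum>j<r. int (vp p (fact (ns ! j)))) - (\<Sum>j<r. int (vp p (fact (ns ! j div 2)))) - (\<Sum>i<r. int (vp p (fact (q i))))"
    using arg_cong[OF eq, of int] unfolding v vp_not_dvd[OF M] by simp
  also have "(\<Sum>i<r. int (vp p (fact (q i)))) = (\<Sum>a\<in>core (set ns). int (vp p (fact a)))"
    by (rule sum.reindex_bij_betw[OF q])
  finally have "int (vp p ?C) = odd_part_val p ns - (\<Sum>a\<in>core (set ns). int (vp p (fact a)))"
    by (simp add: odd_part_val_def r_def[symmetric] sum_subtractf)
  moreover have "vp p (?C * vandermonde r (\<lambda>i. int (q i))) = vp p ?C + vp p (vandermonde r (\<lambda>i. int (q i)))"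
    by (rule vp_mult[OF p(1) C0 V0])
  ultimately show "2 * int (vp p (coeff (wronskian (map herm ns)) (beta_size (core (set ns))))) = 2 * odd_part_val p ns - hook_val p (core (set ns))"
    using vp_vandermonde_image[OF p(1) inj] unfolding W hook_val_def im by simp
qed

text \<open>Surviving exponents satisfy mu_j <= n_j, so the maximal total leaves only mu = n. This
  makes R monic.\<close>

lemma coeff_wronskian_top:
  assumes "sum_list ns = N + (length ns choose 2)"
  shows "coeff (wronskian (map herm ns)) N = Delta ns" "t > N \<Longrightarrow> coeff (wronskian (map herm ns)) t = 0"
proof -
  define r where "r = length ns"
  define B where "B = sum_list ns"
  have B: "ns ! j \<le> B" if "j < length ns" for j using that elem_le_sum_list[of j ns] by (simp add: B_def)
  have W: "coeff (wronskian (map herm ns)) t = 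
    (\<Sum>\<mu> | \<mu> \<in> PiE {..<r} (\<lambda>_. {..B}) \<and> (\<Sum>j<r. \<mu> j) = t + (r choose 2). 
       (\<Prod>j<r. coeff (herm (ns ! j)) (\<mu> j)) * vandermonde r (\<lambda>j. int (\<mu> j)))" for t
    unfolding r_def by (rule coeff_wronskian_herm) (rule B)
  have sum: "(\<Sum>j<r. ns ! j) = N + (r choose 2)" using assms by (simp add: r_def sum_list_sum_nth lessThan_atLeast0)
  let ?T = "\<lambda>\<mu>. (\<Prod>j<r. coeff (herm (ns ! j)) (\<mu> j)) * vandermonde r (\<lambda>j. int (\<mu> j))"
  have le: "\<mu> j \<le> ns ! j" if "?T \<mu> \<noteq> 0" "j < r" for \<mu> j
  proof (rule ccontr)
    assume "\<not> \<mu> j \<le> ns ! j"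
    then have "coeff (herm (ns ! j)) (\<mu> j) = 0" by (intro coeff_herm_above) simp
    then show False using that by auto
  qed
  show "coeff (wronskian (map herm ns)) t = 0" if "t > N"
    unfolding W
  proof (rule sum.neutral, rule ballI, rule ccontr)
    fix \<mu> assume \<mu>: "\<mu> \<in> {\<mu>. \<mu> \<in> PiE {..<r} (\<lambda>_. {..B}) \<and> (\<Sum>j<r. \<mu> j) = t + (r choose 2)}" and nz: "?T \<mu> \<noteq> 0"
    have "(\<Sum>j<r. \<mu> j) \<le> (\<Sum>j<r. ns ! j)" by (rule sum_mono) (use le[OF nz] in auto)
    then show False using \<mu> sum that by simp
  qed
  let ?S = "{\<mu>. \<mu> \<in> PiE {..<r} (\<lambda>_. {..B}) \<and> (\<Sum>j<r. \<mu> j) = N + (r choose 2)}"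
  let ?m = "restrict ((!) ns) {..<r}"
  have fS: "finite ?S" by (rule finite_subset[of _ "PiE {..<r} (\<lambda>_. {..B})"]) (auto intro!: finite_PiE)
  have "coeff (wronskian (map herm ns)) N = (\<Sum>\<mu>\<in>{?m}. ?T \<mu>)"
    unfolding W
  proof (rule sum.mono_neutral_right[OF fS])
    show "{?m} \<subseteq> ?S" using B sum by (auto simp: r_def)
    show "\<forall>\<mu>\<in>?S - {?m}. ?T \<mu> = 0"
    proof (rule ballI, rule ccontr)
      fix \<mu> assume \<mu>: "\<mu> \<in> ?S - {?m}" and nz: "?T \<mu> \<noteq> 0"
      have "\<mu> j = ns ! j" if "j < r" for j
      proof (rule ccontr)
        assume "\<mu> j \<noteq> ns ! j"
        then have "\<mu> j < ns ! j" using le[OF nz that] by simp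
        then have "(\<Sum>j<r. \<mu> j) < (\<Sum>j<r. ns ! j)" using le[OF nz] that by (intro sum_strict_mono_ex1) auto
        then show False using \<mu> sum by simp
      qed
      then have "\<mu> = ?m" using \<mu> by (intro ext) (auto simp: PiE_def extensional_def)
      then show False using \<mu> by blast
    qed
  qed
  also have "\<dots> = vandermonde r (\<lambda>j. int (ns ! j))"
    using vandermonde_cong[of r "\<lambda>j. int (?m j)" "\<lambda>j. int (ns ! j)"] by (simp add: degree_herm)
  finally show "coeff (wronskian (map herm ns)) N = Delta ns" by (simp add: Delta_vandermonde r_def)
qed

subsection \<open>Slope bounds\<close>

lemma length_degseq [simp]: "length (degseq lam) = length lam"
  by (simp add: degseq_def)

lemma nth_degseq: "i < length lam \<Longrightarrow> degseq lam ! i = lam ! (length lam - 1 - i) + i"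
  by (simp add: degseq_def)

lemma distinct_degseq:
  assumes "is_partition lam"
  shows "distinct (degseq lam)"
proof -
  have "degseq lam ! i < degseq lam ! j" if "i < j" "j < length lam" for i j
  proof -
    have "lam ! (length lam - 1 - i) \<le> lam ! (length lam - 1 - j)"
      using assms that by (auto simp: is_partition_def sorted_wrt_iff_nth_less)
    then show ?thesis using that by (simp add: nth_degseq)
  qed
  then have "sorted_wrt (<) (degseq lam)" by (simp add: sorted_wrt_iff_nth_less)
  then show ?thesis using strict_sorted_iff by blast
qed

lemma sum_list_degseq: "sum_list (degseq lam) = part_size lam + (length lam choose 2)"
proof -
  let ?r = "length lam"
  have "sum_list (degseq lam) = (\<Sum>i<?r. lam ! (?r - Suc i) + i)"
    by (simp add: sum_list_sum_nth lessThan_atLeast0 nth_degseq)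
  also have "\<dots> = (\<Sum>i<?r. lam ! (?r - Suc i)) + (\<Sum>i<?r. i)" by (rule sum.distrib)
  also have "(\<Sum>i<?r. lam ! (?r - Suc i)) = (\<Sum>i<?r. lam ! i)" by (rule sum.nat_diff_reindex)
  also have "\<dots> = part_size lam" by (simp add: part_size_def sum_list_sum_nth lessThan_atLeast0)
  finally show ?thesis by (simp add: sum_lessThan_choose)
qed

text \<open>Each surviving term belongs to a set with the given 2-core, hence of at least its
  size.\<close>

lemma coeff_wronskian_below_core:
  assumes ns: "distinct ns" and t: "t < beta_size (core (set ns))"
  shows "coeff (wronskian (map herm ns)) t = 0"
proof -
  define r where "r = length ns"
  define B where "B = sum_list ns"
  have B: "ns ! j \<le> B" if "j < length ns" for j using that elem_le_sum_list[of j ns] by (simp add: B_def)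
  have W: "coeff (wronskian (map herm ns)) t = 
    (\<Sum>\<mu> | \<mu> \<in> PiE {..<r} (\<lambda>_. {..B}) \<and> (\<Sum>j<r. \<mu> j) = t + (r choose 2). 
       (\<Prod>j<r. coeff (herm (ns ! j)) (\<mu> j)) * vandermonde r (\<lambda>j. int (\<mu> j)))"
    unfolding r_def by (rule coeff_wronskian_herm) (rule B)
  show ?thesis unfolding W
  proof (rule sum.neutral, rule ballI, rule ccontr)
    fix \<mu> assume "\<mu> \<in> {\<mu>. \<mu> \<in> PiE {..<r} (\<lambda>_. {..B}) \<and> (\<Sum>j<r. \<mu> j) = t + (r choose 2)}"
      and nz: "(\<Prod>j<r. coeff (herm (ns ! j)) (\<mu> j)) * vandermonde r (\<lambda>j. int (\<mu> j)) \<noteq> 0"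
    then have s: "(\<Sum>j<r. \<mu> j) = t + (r choose 2)" by blast
    note props = nonzero_term_props[OF ns s[unfolded r_def] nz[unfolded r_def], folded r_def]
    have "core (\<mu> ` {..<r}) = core (set ns)" by (rule core_cong) (use props in auto)
    then show False using beta_size_core_le[of "\<mu> ` {..<r}"] props(4) t by simp
  qed
qed

lemma coeff_Rpoly:
  assumes lam: "is_partition lam" and D: "Delta (degseq lam) \<noteq> 0"
  shows "coeff (Rpoly lam) k * Delta (degseq lam) = coeff (wronskian (map herm (degseq lam))) (two_core_size lam + k)"
proof -
  let ?W = "wronskian (map herm (degseq lam))"
  have He: "coeff (He_part lam) t = coeff ?W t div Delta (degseq lam)" for t
    by (simp add: He_part_def coeff_map_poly)
  have "coeff (Rpoly lam) k = coeff (He_part lam) (two_core_size lam + k)"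
    unfolding Rpoly_def
    by (rule coeff_div_X_power) (simp add: He two_core_size_eq coeff_wronskian_below_core[OF distinct_degseq[OF lam]])
  then show ?thesis unfolding He using Delta_dvd_coeff_wronskian by simp
qed

lemma double_beta_size_eq_imp:
  assumes "alt_sum A * (alt_sum A - 1) = 2 * int ((m + 1) choose 2)"
  shows "alt_sum A = int m + 1 \<or> alt_sum A = - int m"
proof -
  have "(alt_sum A - (int m + 1)) * (alt_sum A + int m) = 0"
    using assms double_choose_2[of "m + 1"] by (simp add: algebra_simps)
  then show ?thesis by auto
qed

lemma Rpoly_props:
  assumes lam: "is_partition lam" and p: "prime p" "odd p" and D: "\<not> int p dvd Delta (degseq lam)"
    and gt: "part_size lam > two_core_size lam"
  defines "A \<equiv> set (degseq lam)" and "R \<equiv> Rpoly lam"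
  shows "coeff R 0 \<noteq> 0" "2 * int (vp p (coeff R 0)) = 2 * odd_part_val p (degseq lam) - hook_val p (core A)"
    "coeff R (part_size lam - two_core_size lam) = 1" "degree R > 0"
    "coeff R k \<noteq> 0 \<Longrightarrow> k \<le> part_size lam - two_core_size lam"
    "coeff R k \<noteq> 0 \<Longrightarrow> (\<And>A'. finite A' \<Longrightarrow> alt_sum A' = alt_sum A \<Longrightarrow> beta_size A' = two_core_size lam + k \<Longrightarrow> hook_val p A' \<le> H)
      \<Longrightarrow> 2 * (int (vp p (coeff R 0)) - int (vp p (coeff R k))) \<le> H"
proof -
  let ?ns = "degseq lam"
  let ?W = "wronskian (map herm ?ns)"
  have dist: "distinct ?ns" by (rule distinct_degseq[OF lam])
  have D0: "Delta ?ns \<noteq> 0" using D by auto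
  have R: "coeff R k * Delta ?ns = coeff ?W (two_core_size lam + k)" for k
    unfolding R_def by (rule coeff_Rpoly[OF lam D0])
  have s: "two_core_size lam = beta_size (core A)" by (simp add: two_core_size_eq A_def)
  have vR: "vp p (coeff R k) = vp p (coeff ?W (two_core_size lam + k))" for k
  proof (cases "coeff R k = 0")
    case True
    then show ?thesis using R[of k] by simp
  next
    case False
    have "vp p (coeff R k * Delta ?ns) = vp p (coeff R k)"
      using vp_mult[OF p(1) False D0] vp_not_dvd[OF D] by simp
    then show ?thesis by (simp only: R)
  qed
  note low = vp_coeff_wronskian_lowest[OF p dist D, folded A_def, folded s]
  show R0: "coeff R 0 \<noteq> 0" using R[of 0] low(1) by auto
  show v0: "2 * int (vp p (coeff R 0)) = 2 * odd_part_val p ?ns - hook_val p (core A)" using low(2) vR[of 0] by simp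
  have top: "coeff ?W (part_size lam) = Delta ?ns" "t > part_size lam \<Longrightarrow> coeff ?W t = 0" for t
    using coeff_wronskian_top[of ?ns "part_size lam"] sum_list_degseq[of lam] by auto
  show R1: "coeff R (part_size lam - two_core_size lam) = 1"
    using R[of "part_size lam - two_core_size lam"] gt top(1) D0 by simp
  have "part_size lam - two_core_size lam \<le> degree R" by (rule le_degree) (simp add: R1)
  then show "degree R > 0" using gt by simp
  show "coeff R k \<noteq> 0 \<Longrightarrow> k \<le> part_size lam - two_core_size lam"
  proof (rule ccontr)
    assume "coeff R k \<noteq> 0" "\<not> k \<le> part_size lam - two_core_size lam"
    then show False using top(2)[of "two_core_size lam + k"] R[of k] D0 gt by simp
  qed
  show "2 * (int (vp p (coeff R 0)) - int (vp p (coeff R k))) \<le> H"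
    if nz: "coeff R k \<noteq> 0" and H: "\<And>A'. finite A' \<Longrightarrow> alt_sum A' = alt_sum A \<Longrightarrow> beta_size A' = two_core_size lam + k \<Longrightarrow> hook_val p A' \<le> H"
  proof -
    have "coeff ?W (two_core_size lam + k) \<noteq> 0" using R[of k] nz D0 by auto
    then have "2 * int (vp p (coeff R k)) \<ge> 2 * odd_part_val p ?ns - H"
      unfolding vR by (rule coeff_wronskian_vp_ge[OF p dist]) (use H in \<open>simp add: A_def\<close>)
    moreover have "hook_val p (core A) \<ge> 0" using hook_val_bounds[OF p finite_core[of A]] by blast
    ultimately show ?thesis using v0 by simp
  qed
qed

text \<open>With empty core, coefficient k involves sets of size k only, whose doubled hook
  valuation is at most 2 v(k!).\<close>

lemma slope_bound_empty_core:
  assumes lam: "is_partition lam" and p: "prime p" "odd p" and D: "\<not> int p dvd Delta (degseq lam)"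
    and gt: "part_size lam > two_core_size lam" and m: "two_core_size lam = 0"
  shows "right_edge_slope p (Rpoly lam) < 1 / (real p - 1)"
    "part_size lam < p ^ 2 \<Longrightarrow> right_edge_slope p (Rpoly lam) \<le> 1 / real p"
proof -
  note props = Rpoly_props[OF lam p D gt]
  let ?R = "Rpoly lam"
  obtain k where k: "k \<ge> 1" "coeff ?R k \<noteq> 0" 
    "right_edge_slope p ?R = (real (vp p (coeff ?R 0)) - real (vp p (coeff ?R k))) / real k"
    using right_edge_slope(1)[OF props(1,4)] by blast
  define V where "V = vp p (fact k)"
  have p1: "p > 1" using prime_gt_1_nat[OF p(1)] .
  have "2 * (int (vp p (coeff ?R 0)) - int (vp p (coeff ?R k))) \<le> 2 * int V"
    by (rule props(6)[OF k(2)]) (use hook_val_bounds[OF p] m in \<open>auto simp: V_def\<close>)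
  then have "int (vp p (coeff ?R 0)) - int (vp p (coeff ?R k)) \<le> int V" by simp
  then have "real (vp p (coeff ?R 0)) - real (vp p (coeff ?R k)) \<le> real V" by linarith
  then have sl: "right_edge_slope p ?R \<le> real V / real k" unfolding k(3) by (rule divide_right_mono) simp
  have "V * (p - 1) \<le> k - 1" unfolding V_def by (rule vp_fact_bound[OF p(1) k(1)])
  then have "V * (p - 1) < k" using k(1) by simp
  then have "real (V * (p - 1)) < real k" by (simp only: of_nat_less_iff)
  then have "real V * (real p - 1) < real k" using p1 by (simp add: of_nat_diff)
  then have "real V / real k < 1 / (real p - 1)" using p1 k(1) by (simp add: field_simps)
  then show "right_edge_slope p ?R < 1 / (real p - 1)" using sl by simp
  show "right_edge_slope p ?R \<le> 1 / real p" if lt: "part_size lam < p ^ 2"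
  proof -
    \<comment> \<open>Below p^2 Legendre's formula has a single term, so v(k!) is k div p.\<close>
    have "k < p * p" using props(5)[OF k(2)] lt m by (simp add: power2_eq_square)
    then have "k div p < p" by (simp add: less_mult_imp_div_less)
    then have "V = k div p" unfolding V_def by (subst vp_fact_div[OF p(1)]) (simp add: vp_fact_less[OF p(1)])
    then have "V * p \<le> k" by simp
    then have "real V * real p \<le> real k" by (metis of_nat_le_iff of_nat_mult)
    then have "real V / real k \<le> 1 / real p" using p1 k(1) by (simp add: field_simps)
    then show ?thesis using sl by simp
  qed
qed

lemma slope_bound_core:
  assumes lam: "is_partition lam" and p: "prime p" "odd p" and D: "\<not> int p dvd Delta (degseq lam)"
    and gt: "part_size lam > two_core_size lam" and m: "two_core_size lam = (m + 1) choose 2" "m \<ge> 1" "p > 2 * m - 1"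
  shows "right_edge_slope p (Rpoly lam) \<le> 1 / (real p - (2 * real m - 1))"
proof -
  note props = Rpoly_props[OF lam p D gt]
  let ?R = "Rpoly lam" and ?A = "set (degseq lam)"
  obtain k where k: "k \<ge> 1" "coeff ?R k \<noteq> 0" 
    "right_edge_slope p ?R = (real (vp p (coeff ?R 0)) - real (vp p (coeff ?R k))) / real k"
    using right_edge_slope(1)[OF props(1,4)] by blast
  define P where "P = int p - (2 * int m - 1)"
  have P: "P > 0" using m by (simp add: P_def)
  \<comment> \<open>\<open>Rpoly_props\<close> asks for an integral bound; hook values are integers,
    so rounding down loses nothing.\<close>
  define H where "H = (2 * int k) div P"
  have d: "alt_sum ?A = int m + 1 \<or> alt_sum ?A = - int m"
    by (rule double_beta_size_eq_imp) (use core_card_alt_sum(3)[of ?A] m in \<open>simp add: two_core_size_eq\<close>)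
  have "2 * (int (vp p (coeff ?R 0)) - int (vp p (coeff ?R k))) \<le> H"
  proof (rule props(6)[OF k(2)])
    fix A' assume A': "finite A'" "alt_sum A' = alt_sum ?A" "beta_size A' = two_core_size lam + k"
    have "hook_val p A' * P \<le> 2 * int k"
      using hook_val_bound_core[OF p m(2,3) A'(1)] d A' m(1) by (simp add: P_def)
    then have "hook_val p A' * P div P \<le> H" unfolding H_def using P by (intro zdiv_mono1)
    then show "hook_val p A' \<le> H" using P by simp
  qed
  moreover have "H * P \<le> 2 * int k" unfolding H_def using P by (metis div_mult_mod_eq le_add_same_cancel1 pos_mod_sign)
  ultimately have "2 * (int (vp p (coeff ?R 0)) - int (vp p (coeff ?R k))) * P \<le> 2 * int k"
    using P mult_right_mono[of _ H P] by (meson order.trans less_imp_le)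
  then have "2 * ((int (vp p (coeff ?R 0)) - int (vp p (coeff ?R k))) * P) \<le> 2 * int k" by (simp only: mult.assoc)
  then have "(int (vp p (coeff ?R 0)) - int (vp p (coeff ?R k))) * P \<le> int k" by linarith
  then have "real_of_int ((int (vp p (coeff ?R 0)) - int (vp p (coeff ?R k))) * P) \<le> real k" by linarith
  moreover have "real_of_int P = real p - (2 * real m - 1)" by (simp add: P_def)
  ultimately have "(real (vp p (coeff ?R 0)) - real (vp p (coeff ?R k))) * (real p - (2 * real m - 1)) \<le> real k"
    by simp
  moreover have "real p - (2 * real m - 1) > 0" using P \<open>real_of_int P = _\<close> by linarith
  ultimately show ?thesis unfolding k(3) using k(1) by (simp add: field_simps)
qed

section \<open>Partitions attaining the bounds\<close>

lemma slope_ge_if_vanishing_core: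
  assumes lam: "is_partition lam" and p: "prime p" "odd p" and D: "\<not> int p dvd Delta (degseq lam)"
    and gt: "part_size lam > two_core_size lam" and h: "hook_val p (core (set (degseq lam))) \<le> 0"
    and w: "odd_part_val p (degseq lam) = int w"
  shows "real w / real (part_size lam - two_core_size lam) \<le> right_edge_slope p (Rpoly lam)"
proof -
  note props = Rpoly_props[OF lam p D gt]
  have "int (vp p (coeff (Rpoly lam) 0)) \<ge> int w" using props(2) h w by simp
  then have "real w \<le> real (vp p (coeff (Rpoly lam) 0))" by simp
  \<comment> \<open>The chord to the leading coefficient 1, of valuation 0, has slope v(a_0)/deg R
    and cannot exceed the maximal slope.\<close>
  then have "real w / real (part_size lam - two_core_size lam) \<le> 
     (real (vp p (coeff (Rpoly lam) 0)) - real (vp p (coeff (Rpoly lam) (part_size lam - two_core_size lam)))) / real (part_size lam - two_core_size lam)"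
    unfolding props(3) by (intro divide_right_mono) (simp_all add: vp_def)
  also have "\<dots> \<le> right_edge_slope p (Rpoly lam)"
    by (rule right_edge_slope(2)[OF props(1,4)]) (use gt props(3) in simp_all)
  finally show ?thesis .
qed

lemma slope_attained_empty_core:
  assumes p: "prime p" "odd p"
  shows "\<exists>lam. is_partition lam \<and> two_core_size lam = 0 \<and> \<not> int p dvd Delta (degseq lam) \<and>
     part_size lam > two_core_size lam \<and> right_edge_slope p (Rpoly lam) \<ge> 1 / real p"
proof -
  have p1: "p > 1" using prime_gt_1_nat[OF p(1)] .
  have p2: "p > 2" using p p1 by (cases "p = 2") auto
  \<comment> \<open>Two consecutive entries p and p+1: one is even and one odd, so the core is
    empty, and Delta is 1. Each contributes one factor p, giving 2/(2p). The single part p would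
    have the odd entry p and a core of size 1.\<close>
  let ?lam = "[p, p]"
  have ns: "degseq ?lam = [p, Suc p]" by (simp add: degseq_def upt_rec numeral_2_eq_2)
  have lam: "is_partition ?lam" by (simp add: is_partition_def)
  have "Delta (degseq ?lam) = 1" by (simp add: Delta_vandermonde ns vandermonde_def numeral_2_eq_2)
  then have D: "\<not> int p dvd Delta (degseq ?lam)" using p1 by simp
  have "alt_sum (set (degseq ?lam)) = 0" by (simp add: ns alt_sum_def)
  then have s: "two_core_size ?lam = 0" using core_card_alt_sum(3)[of "set (degseq ?lam)"] by (simp add: two_core_size_eq)
  have gt: "part_size ?lam > two_core_size ?lam" using p1 by (simp add: s part_size_def)
  have h: "hook_val p (core (set (degseq ?lam))) \<le> 0"
    using hook_val_bounds[OF p finite_core[of "set (degseq ?lam)"]] s by (simp add: two_core_size_eq vp_def)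
  have v1: "vp p (fact p) = 1" "vp p (fact (Suc p)) = 1"
    using vp_fact_div[OF p(1), of p] vp_fact_div[OF p(1), of "Suc p"] p1
    by (simp_all add: div_Suc mod_Suc vp_def)
  have v2: "vp p (fact (p div 2)) = 0" "vp p (fact (Suc p div 2)) = 0"
    using p2 by (auto intro!: vp_fact_less[OF p(1)])
  have "odd_part_val p (degseq ?lam) = int 2" using v1 v2 by (simp add: odd_part_val_def ns numeral_2_eq_2)
  from slope_ge_if_vanishing_core[OF lam p D gt h this]
  have "2 / real (2 * p) \<le> right_edge_slope p (Rpoly ?lam)" by (simp add: s part_size_def)
  then show ?thesis using lam D s gt by (intro exI[of _ ?lam]) simp
qed

lemma slope_attained_core:
  assumes p: "prime p" "odd p" and m: "m \<ge> 1" "p > 2 * m - 1"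
  shows "\<exists>lam. is_partition lam \<and> two_core_size lam = (m + 1) choose 2 \<and> \<not> int p dvd Delta (degseq lam) \<and>
     part_size lam > two_core_size lam \<and> right_edge_slope p (Rpoly lam) = 1 / (real p - (2 * real m - 1))"
proof -
  have p1: "p > 1" using prime_gt_1_nat[OF p(1)] .
  obtain l where l: "m = Suc l" using m by (cases m) auto
  have pm: "p \<ge> 2 * m + 1" using m p(2) by presburger
  \<comment> \<open>Degree sequence 1, 3, ..., 2m-3, p: the core 1, 3, ..., 2m-1 with its top entry
    raised to p. The size grows by p-(2m-1), and p is the only entry whose factorial is divisible by
    p.\<close>
  define lam where "lam = map (\<lambda>i. if i = 0 then p - l else m - i) [0..<m]"
  have len: "length lam = m" by (simp add: lam_def)
  have lam_nth: "lam ! i = (if i = 0 then p - l else m - i)" if "i < m" for i using that by (simp add: lam_def)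
  have lam: "is_partition lam"
    unfolding is_partition_def sorted_wrt_iff_nth_less len
  proof (intro allI impI)
    fix i j assume "i < j" "j < m"
    then show "lam ! j \<le> lam ! i" using pm l lam_nth by (cases "i = 0") auto
  qed
  have nth: "degseq lam ! i = (if i = l then p else 2 * i + 1)" if "i < m" for i
  proof -
    have "degseq lam ! i = lam ! (l - i) + i" using that by (simp add: nth_degseq len l)
    then show ?thesis using that pm lam_nth[of "l - i"] by (auto simp: l)
  qed
  have sumns: "sum_list (degseq lam) = l * l + p"
  proof -
    have "sum_list (degseq lam) = (\<Sum>i<m. if i = l then p else 2 * i + 1)"
      by (simp add: sum_list_sum_nth len lessThan_atLeast0 nth)
    also have "\<dots> = (\<Sum>i<l. 2 * i + 1) + p" unfolding l by simp
    also have "(\<Sum>i<l. 2 * i + 1) = l * l" by (induction l) (auto simp: algebra_simps)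
    finally show ?thesis .
  qed
  have dist: "distinct (degseq lam)" by (rule distinct_degseq[OF lam])
  have bij: "bij_betw ((!) (degseq lam)) {..<m} (set (degseq lam))" 
    by (rule bij_betw_nth) (use dist len in auto)
  have d: "alt_sum (set (degseq lam)) = - int m"
  proof -
    have "alt_sum (set (degseq lam)) = (\<Sum>i<m. (-1) ^ (degseq lam ! i))"
      unfolding alt_sum_def by (rule sum.reindex_bij_betw[OF bij, symmetric])
    also have "\<dots> = (\<Sum>i<m. -1)" using p(2) by (intro sum.cong) (auto simp: nth)
    finally show ?thesis by simp
  qed
  have s: "two_core_size lam = (m + 1) choose 2"
    using core_card_alt_sum(3)[of "set (degseq lam)"] double_choose_2[of "m + 1"] 
    by (simp add: two_core_size_eq d algebra_simps)
  have sz: "part_size lam = two_core_size lam + (p - (2 * m - 1))"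
  proof -
    have "int (l * l + p) = int (part_size lam) + int (m choose 2)" using sum_list_degseq[of lam] sumns len by simp
    then have "2 * (int l * int l + int p) = 2 * int (part_size lam) + int m * (int m - 1)"
      using double_choose_2[of m] by simp
    moreover have "2 * int (two_core_size lam) = (int m + 1) * int m" using double_choose_2[of "m + 1"] s by simp
    ultimately have "2 * int (part_size lam) = 2 * int (two_core_size lam) + 2 * (int p - (2 * int m - 1))"
      unfolding l by (simp add: algebra_simps)
    then have "int (part_size lam) = int (two_core_size lam) + (int p - (2 * int m - 1))" by simp
    moreover have "int (p - (2 * m - 1)) = int p - (2 * int m - 1)" using pm m by (simp add: of_nat_diff)
    ultimately have "int (part_size lam) = int (two_core_size lam + (p - (2 * m - 1)))" by simp
    then show ?thesis by (simp only: of_nat_eq_iff)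
  qed
  have gt: "part_size lam > two_core_size lam" using sz pm by simp
  have D: "\<not> int p dvd Delta (degseq lam)"
  proof
    assume "int p dvd Delta (degseq lam)"
    then have "int p dvd (\<Prod>j<m. \<Prod>i<j. int (degseq lam ! j) - int (degseq lam ! i))" 
      by (simp add: Delta_vandermonde vandermonde_def len)
    then obtain i j where ij: "j < m" "i < j" "int p dvd int (degseq lam ! j) - int (degseq lam ! i)"
      using p(1) by (auto simp: prime_dvd_prod_iff)
    have "0 < int (degseq lam ! j) - int (degseq lam ! i)" "int (degseq lam ! j) - int (degseq lam ! i) < int p"
      using ij pm by (auto simp: nth l)
    then show False using ij(3) zdvd_not_zless by blast
  qed
  \<comment> \<open>The core exceeds its own size by k = 0, so the bound for sets with this core
    makes its hook value vanish.\<close>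
  have h: "hook_val p (core (set (degseq lam))) \<le> 0"
  proof -
    have "hook_val p (core (set (degseq lam))) * (int p - (2 * int m - 1)) \<le> 0"
      using hook_val_bound_core[OF p m finite_core[of "set (degseq lam)"]] s d
      by (simp add: two_core_size_eq core_card_alt_sum(2))
    moreover have "int p - (2 * int m - 1) > 0" using pm by linarith
    ultimately show ?thesis by (simp add: mult_le_0_iff)
  qed
  have w: "odd_part_val p (degseq lam) = int 1"
  proof -
    have "odd_part_val p (degseq lam) = (\<Sum>j<m. if j = l then 1 else 0)"
      unfolding odd_part_val_def length_degseq len
    proof (rule sum.cong[OF refl])
      fix j assume j: "j \<in> {..<m}"
      have "vp p (fact p) = 1" using vp_fact_div[OF p(1), of p] p1 by (simp add: vp_def)
      moreover have "vp p (fact (p div 2)) = 0" using p1 by (intro vp_fact_less[OF p(1)]) simp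
      moreover have "vp p (fact (2 * j + 1)) = 0" "vp p (fact ((2 * j + 1) div 2)) = 0" if "j \<noteq> l"
      proof -
        have lt: "2 * j + 1 < p" using that j pm by (simp add: l)
        show "vp p (fact (2 * j + 1)) = 0" by (rule vp_fact_less[OF p(1) lt])
        show "vp p (fact ((2 * j + 1) div 2)) = 0" by (rule vp_fact_less[OF p(1)]) (use lt in simp)
      qed
      ultimately show "int (vp p (fact (degseq lam ! j))) - int (vp p (fact (degseq lam ! j div 2))) = (if j = l then 1 else 0)"
        using j by (simp add: nth)
    qed
    then show ?thesis by (simp add: l)
  qed
  have "real (part_size lam - two_core_size lam) = real p - (2 * real m - 1)"
    using sz pm m by (simp add: of_nat_diff)
  then have "1 / (real p - (2 * real m - 1)) \<le> right_edge_slope p (Rpoly lam)"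
    using slope_ge_if_vanishing_core[OF lam p D gt h w] by simp
  moreover have "right_edge_slope p (Rpoly lam) \<le> 1 / (real p - (2 * real m - 1))"
    by (rule slope_bound_core[OF lam p D gt s m])
  ultimately show ?thesis using lam s D gt by (intro exI[of _ lam]) simp
qed

lemma odd_primeI: "prime (p::nat) \<Longrightarrow> p > 2 \<Longrightarrow> odd p"
  using prime_odd_nat by blast

theorem mainTheorem4:
  shows "(\<forall>lam m p. is_partition lam \<and> two_core_size lam = (m + 1) choose 2 \<and> prime p \<and>
            p > max 2 (2 * m - 1) \<and> \<not> int p dvd Delta (degseq lam) \<and>
            part_size lam > two_core_size lam \<longrightarrow>
          (m = 0 \<longrightarrow> right_edge_slope p (Rpoly lam) < 1 / (real p - 1) \<and>
              (part_size lam < p ^ 2 \<longrightarrow> right_edge_slope p (Rpoly lam) \<le> 1 / real p)) \<and>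
          (m \<ge> 1 \<longrightarrow> right_edge_slope p (Rpoly lam) \<le> 1 / (real p - (2 * real m - 1))))
   \<and> (\<forall>m p. m \<ge> 1 \<and> prime p \<and> p > max 2 (2 * m - 1) \<longrightarrow>
        (\<exists>lam. is_partition lam \<and> two_core_size lam = (m + 1) choose 2 \<and>
           \<not> int p dvd Delta (degseq lam) \<and> part_size lam > two_core_size lam \<and>
           right_edge_slope p (Rpoly lam) = 1 / (real p - (2 * real m - 1))))
   \<and> (\<forall>p. prime p \<and> p \<ge> 3 \<longrightarrow>
        (\<exists>lam. is_partition lam \<and> two_core_size lam = 0 \<and>
           \<not> int p dvd Delta (degseq lam) \<and> part_size lam > two_core_size lam \<and>
           right_edge_slope p (Rpoly lam) \<ge> 1 / real p))"
proof (intro conjI allI impI)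
  fix lam m p
  assume a: "is_partition lam \<and> two_core_size lam = (m + 1) choose 2 \<and> prime p \<and>
            p > max 2 (2 * m - 1) \<and> \<not> int p dvd Delta (degseq lam) \<and>
            part_size lam > two_core_size lam"
  then have o: "odd p" using odd_primeI[of p] by simp
  show "right_edge_slope p (Rpoly lam) < 1 / (real p - 1)" if "m = 0"
    using slope_bound_empty_core(1)[of lam p] a o that by (simp add: numeral_2_eq_2)
  show "right_edge_slope p (Rpoly lam) \<le> 1 / real p" if "m = 0" "part_size lam < p ^ 2"
    using slope_bound_empty_core(2)[of lam p] a o that by (simp add: numeral_2_eq_2)
  show "right_edge_slope p (Rpoly lam) \<le> 1 / (real p - (2 * real m - 1))" if "m \<ge> 1"
    using slope_bound_core[of lam p m] a o that by simp
next
  fix m p :: nat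
  assume a: "m \<ge> 1 \<and> prime p \<and> p > max 2 (2 * m - 1)"
  then have "odd p" using odd_primeI[of p] by simp
  then show "\<exists>lam. is_partition lam \<and> two_core_size lam = (m + 1) choose 2 \<and>
           \<not> int p dvd Delta (degseq lam) \<and> part_size lam > two_core_size lam \<and>
           right_edge_slope p (Rpoly lam) = 1 / (real p - (2 * real m - 1))"
    using slope_attained_core[of p m] a by simp
next
  fix p :: nat
  assume a: "prime p \<and> p \<ge> 3"
  then have "odd p" using odd_primeI[of p] by simp
  then show "\<exists>lam. is_partition lam \<and> two_core_size lam = 0 \<and>
           \<not> int p dvd Delta (degseq lam) \<and> part_size lam > two_core_size lam \<and>
           right_edge_slope p (Rpoly lam) \<ge> 1 / real p"
    using slope_attained_empty_core[of p] a by simp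
qed

end
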